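(* Let $g$ be a totally positive function of finite type $m\ge 2$ and let $a,M\in\mathbb{N}$. Let $Sg=(g(k))_{k\in\mathbb{Z}}$. If $a/M<1$, then the Gabor family $\mathcal{G}(Sg,a,1/M)=\{M_{l/M}T_{ka}Sg: k\in\mathbb{Z},\ l=0,\ldots,M-1\}$ is a frame for $\ell^2(\mathbb{Z})$, and there exists a finitely supported dual window $\gamma\in\ell^2(\mathbb{Z})$ for this frame. If $a/M>1$, then $\mathcal{G}(Sg,a,1/M)$ is a Riesz sequence in $\ell^2(\mathbb{Z})$.
   Context: $j$ is the imaginary unit and $\hat g(\xi)=\int g(x)e^{-2\pi jx\xi}dx$. A function $g\in L^1(\mathbb{R})$ is totally positive of finite type $m\in\mathbb{N}$ if $\hat g(\xi)=C\prod_{k=1}^m(1+2\pi j\delta_k\xi)^{-1}$ with $C>0$ and nonzero real $\delta_k$ (for $m\ge2$ such $g$ is continuous with exponential decay). On $\ell^2(\mathbb{Z})$: $M_\xi T_k f(l)=f(l-k)e^{2\pi j\xi l}$. A family $(e_i)$ in a Hilbert space $H$ is a frame if there are $A,B>0$ with $A\|f\|^2\le\sum_i|\langle f,e_i\rangle|^2\le B\|f\|^2$ for all $f\in H$; it is a Riesz sequence if there are $A',B'>0$ with $A'\|c\|_2^2\le\|\sum_i c_ie_i\|^2\le B'\|c\|_2^2$ for all finitely supported (equivalently all square-summable) coefficient sequences $c$. A dual window for the frame $\mathcal{G}(Sg,a,1/M)$ is $\gamma\in\ell^2(\mathbb{Z})$ such that $\mathcal{G}(\gamma,a,1/M)$ is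 a frame and $f=\sum_{k\in\mathbb{Z}}\sum_{l=0}^{M-1}\langle f,M_{l/M}T_{ka}Sg\rangle M_{l/M}T_{ka}\gamma$ for all $f\in\ell^2(\mathbb{Z})$. *)

theory Defs
  imports "HOL-Analysis.Analysis"
begin

definition fourier :: "(real \<Rightarrow> real) \<Rightarrow> real \<Rightarrow> complex" where
  "fourier g \<xi> = integral\<^sup>L lborel
      (\<lambda>x. complex_of_real (g x) * exp (- 2 * complex_of_real pi * \<i> * complex_of_real (x * \<xi>)))"

definition totally_positive_finite_type :: "(real \<Rightarrow> real) \<Rightarrow> nat \<Rightarrow> bool" where
  "totally_positive_finite_type g m \<longleftrightarrow>
     integrable lborel g \<and>
     (\<exists>C::real. \<exists>\<delta>::nat \<Rightarrow> real. C > 0 \<and> (\<forall>k<m. \<delta> k \<noteq> 0) \<and>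
        (\<forall>\<xi>. fourier g \<xi> =
              complex_of_real C * (\<Prod>k<m. inverse (1 + 2 * complex_of_real pi * \<i> * complex_of_real (\<delta> k * \<xi>)))))"

definition l2 :: "(int \<Rightarrow> complex) set" where
  "l2 = {f. (\<lambda>n. (cmod (f n))\<^sup>2) summable_on UNIV}"

definition l2_inner :: "(int \<Rightarrow> complex) \<Rightarrow> (int \<Rightarrow> complex) \<Rightarrow> complex" where
  "l2_inner f h = (\<Sum>\<^sub>\<infinity>n. f n * cnj (h n))"

definition l2_norm_sq :: "(int \<Rightarrow> complex) \<Rightarrow> real" where
  "l2_norm_sq f = (\<Sum>\<^sub>\<infinity>n. (cmod (f n))\<^sup>2)"

definition mod_trans :: "real \<Rightarrow> int \<Rightarrow> (int \<Rightarrow> complex) \<Rightarrow> (int \<Rightarrow> complex)" where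
  "mod_trans \<xi> k f = (\<lambda>l. f (l - k) * exp (2 * complex_of_real pi * \<i> * complex_of_real (\<xi> * real_of_int l)))"

definition gabor_index :: "nat \<Rightarrow> (int \<times> nat) set" where
  "gabor_index M = UNIV \<times> {0..<M}"

definition gabor_atom :: "(int \<Rightarrow> complex) \<Rightarrow> nat \<Rightarrow> nat \<Rightarrow> int \<times> nat \<Rightarrow> (int \<Rightarrow> complex)" where
  "gabor_atom g a M i = mod_trans (real (snd i) / real M) (fst i * int a) g"

definition is_frame :: "('i \<Rightarrow> (int \<Rightarrow> complex)) \<Rightarrow> 'i set \<Rightarrow> bool" where
  "is_frame e I \<longleftrightarrow> (\<forall>i\<in>I. e i \<in> l2) \<and>
     (\<exists>A B. A > 0 \<and> B > 0 \<and> (\<forall>f\<in>l2.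
        (\<lambda>i. (cmod (l2_inner f (e i)))\<^sup>2) summable_on I \<and>
        A * l2_norm_sq f \<le> (\<Sum>\<^sub>\<infinity>i\<in>I. (cmod (l2_inner f (e i)))\<^sup>2) \<and>
        (\<Sum>\<^sub>\<infinity>i\<in>I. (cmod (l2_inner f (e i)))\<^sup>2) \<le> B * l2_norm_sq f))"

definition is_riesz_sequence :: "('i \<Rightarrow> (int \<Rightarrow> complex)) \<Rightarrow> 'i set \<Rightarrow> bool" where
  "is_riesz_sequence e I \<longleftrightarrow> (\<forall>i\<in>I. e i \<in> l2) \<and>
     (\<exists>A B. A > 0 \<and> B > 0 \<and> (\<forall>c::'i \<Rightarrow> complex.
        finite {i. c i \<noteq> 0} \<longrightarrow> {i. c i \<noteq> 0} \<subseteq> I \<longrightarrow>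
        A * (\<Sum>i\<in>{i. c i \<noteq> 0}. (cmod (c i))\<^sup>2)
          \<le> l2_norm_sq (\<lambda>n. \<Sum>i\<in>{i. c i \<noteq> 0}. c i * e i n) \<and>
        l2_norm_sq (\<lambda>n. \<Sum>i\<in>{i. c i \<noteq> 0}. c i * e i n)
          \<le> B * (\<Sum>i\<in>{i. c i \<noteq> 0}. (cmod (c i))\<^sup>2)))"

definition l2_has_sum :: "('i \<Rightarrow> (int \<Rightarrow> complex)) \<Rightarrow> 'i set \<Rightarrow> (int \<Rightarrow> complex) \<Rightarrow> bool" where
  "l2_has_sum v I f \<longleftrightarrow> (\<forall>\<epsilon>>0. \<exists>F0. finite F0 \<and> F0 \<subseteq> I \<and>
     (\<forall>F. finite F \<and> F0 \<subseteq> F \<and> F \<subseteq> I \<longrightarrow>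
        l2_norm_sq (\<lambda>n. f n - (\<Sum>i\<in>F. v i n)) < \<epsilon>))"

definition is_dual_window :: "(int \<Rightarrow> complex) \<Rightarrow> (int \<Rightarrow> complex) \<Rightarrow> nat \<Rightarrow> nat \<Rightarrow> bool" where
  "is_dual_window \<gamma> g a M \<longleftrightarrow> \<gamma> \<in> l2 \<and>
     is_frame (gabor_atom \<gamma> a M) (gabor_index M) \<and>
     (\<forall>f\<in>l2. l2_has_sum (\<lambda>i n. l2_inner f (gabor_atom g a M i) * gabor_atom \<gamma> a M i n)
                (gabor_index M) f)"

definition sample :: "(real \<Rightarrow> real) \<Rightarrow> int \<Rightarrow> complex" where
  "sample g k = complex_of_real (g (real_of_int k))"

end

theory Submission
  imports Defs "HOL-Probability.Probability"
begin

text \<open>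
  Modulations by \<open>l/M\<close> only see residues modulo \<open>M\<close>. So a finitely supported \<open>\<gamma>\<close> is a dual window
  as soon as, for every integer \<open>n\<close>, the numbers \<open>\<gamma> (n - k a)\<close> satisfy
  \<open>M (\<Sum>k. \<gamma> (n - k a) g (n + j M - k a)) = \<delta>\<^sub>j\<^sub>0\<close> for all \<open>j\<close>; boundedness of both Gabor systems then gives
  the frame inequalities. For \<open>a > M\<close> the same problem with the roles of \<open>a\<close> and \<open>M\<close> exchanged and with \<open>g (- x)\<close>
  in place of \<open>g\<close> yields a biorthogonal Bessel system, hence the Riesz property.

  The finite linear problem is solved by duality. If it had no solution, some exponential spline with knots of spacing
  \<open>q\<close> and nonzero coefficient at a given knot would vanish at arbitrarily many consecutive points of spacing \<open>p < q\<close>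
  around this knot. Counting sign changes with Rolle's theorem for the operators \<open>1 + \<delta> d/dx\<close>, the spline
  vanishes on a whole interval between two of these points, and the zero set then propagates across the knot.
\<close>

text \<open>A parameter count shows what \<open>p < q\<close> buys. On a window of length T, a
  spline of order m with knots of spacing \<open>q\<close> has about T/q + m free parameters, while
  zeros of spacing \<open>p\<close> impose about T/p conditions; the conditions win once their
  number exceeds about m q / (q - p). The obstacle is that counting alone only yields an interval of
  zeros somewhere in the window, not at the prescribed knot. What remedies this is again
  \<open>p < q\<close>, now used locally: at most one knot is passed between consecutive zeros, and
  one further zero excludes the single new parameter which that knot brings in.

  The \<delta> may have either sign and the kernel of order one jumps, so derivatives are avoided:
  the weight \<open>exp (s / d)\<close> turns 1 + d d/dx into plain differentiation, and Rolle's
  theorem becomes monotonicity of \<open>exp (s / d) * u s\<close>. Duality tames the infinitely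
  many conditions in \<open>j\<close>: a separating functional is a finite combination, so the
  resulting spline is a finite sum and no convergence question arises.\<close>

section \<open>Exponential splines\<close>

text \<open>The differential equation \<open>u + d u' = v\<close> in integrated form, which also makes sense when \<open>v\<close> jumps.\<close>

definition exp_primitive :: "real \<Rightarrow> (real \<Rightarrow> real) \<Rightarrow> (real \<Rightarrow> real) \<Rightarrow> bool" where
  "exp_primitive d v u \<longleftrightarrow> (\<forall>a b. a \<le> b \<longrightarrow>
     ((\<lambda>s. exp (s / d) * v s) has_integral d * (exp (b / d) * u b - exp (a / d) * u a)) {a..b})"

text \<open>The integrand has a fixed sign, so the weighted function moves in one direction. The
  factor \<open>k\<close> covers both signs at once; the point \<open>b\<close> is left out because
  sign information later comes on half-open intervals.\<close>

lemma exp_primitive_mono: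
  assumes "exp_primitive d v u" "a \<le> b" "\<And>s. a \<le> s \<Longrightarrow> s < b \<Longrightarrow> 0 \<le> k * v s"
  shows "0 \<le> k * d * (exp (b / d) * u b - exp (a / d) * u a)"
proof -
  define w where "w = (\<lambda>s. if s = b then 0 else k * (exp (s / d) * v s))"
  have "((\<lambda>s. k * (exp (s / d) * v s)) has_integral
      k * (d * (exp (b / d) * u b - exp (a / d) * u a))) {a..b}"
    using assms(1,2) unfolding exp_primitive_def by (intro has_integral_mult_right) auto
  then have "(w has_integral k * (d * (exp (b / d) * u b - exp (a / d) * u a))) {a..b}"
    by (rule has_integral_spike_finite[of "{b}", rotated 2]) (auto simp: w_def)
  then have "0 \<le> k * (d * (exp (b / d) * u b - exp (a / d) * u a))"
  proof (rule has_integral_nonneg)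
    fix s assume s: "s \<in> {a..b}"
    show "0 \<le> w s"
    proof (cases "s = b")
      case False
      then have "0 \<le> exp (s / d) * (k * v s)" using s assms(3)[of s] by auto
      then show ?thesis using False by (simp add: w_def mult_ac)
    qed (simp add: w_def)
  qed
  then show ?thesis by (simp add: mult_ac)
qed

lemma exp_primitive_continuous:
  assumes "exp_primitive d v u" "d \<noteq> 0"
  shows "continuous_on UNIV u"
proof -
  have "isCont u x" for x
  proof -
    define f where "f = (\<lambda>s. exp (s / d) * v s)"
    have hi: "(f has_integral d * (exp (b / d) * u b - exp (a / d) * u a)) {a..b}" if "a \<le> b" for a b
      using assms(1) that unfolding exp_primitive_def f_def by auto
    have "continuous_on {x-1..x+1} (\<lambda>y. integral {x-1..y} f)"
      using hi[of "x-1" "x+1"] by (intro indefinite_integral_continuous_1) auto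
    then have "continuous_on {x-1..x+1}
        (\<lambda>y. exp (- y / d) * (integral {x-1..y} f / d + exp ((x-1) / d) * u (x-1)))"
      using assms(2) by (intro continuous_intros) auto
    moreover have "exp (- y / d) * (integral {x-1..y} f / d + exp ((x-1) / d) * u (x-1)) = u y"
      if "y \<in> {x-1..x+1}" for y
    proof -
      have "integral {x-1..y} f = d * (exp (y / d) * u y - exp ((x-1) / d) * u (x-1))"
        using hi[of "x-1" y] that by (auto intro: integral_unique)
      then have "integral {x-1..y} f / d + exp ((x-1) / d) * u (x-1) = exp (y / d) * u y"
        using assms(2) by (simp add: field_simps)
      then show ?thesis by (simp add: mult.assoc[symmetric] flip: exp_add)
    qed
    ultimately have "continuous_on {x-1..x+1} u"
      by (metis (no_types, lifting) continuous_on_cong)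
    then show ?thesis by (rule continuous_on_interior) simp
  qed
  then show ?thesis by (simp add: continuous_on_eq_continuous_at)
qed

text \<open>Rolle in weighted form: if \<open>k * v\<close> were never positive on [a, b], then
  \<open>exp (s / d) * u s\<close> would be monotone with value 0 at both ends, hence 0 at
  \<open>c\<close>. Since \<open>k\<close> is arbitrary, \<open>v\<close> takes both signs.\<close>

lemma exp_primitive_signs:
  assumes "exp_primitive d v u" "d \<noteq> 0" "u a = 0" "u b = 0" "a \<le> c" "c \<le> b" "u c \<noteq> 0" "k \<noteq> 0"
  obtains s where "a \<le> s" "s \<le> b" "k * v s > 0"
proof -
  have "\<exists>s. a \<le> s \<and> s \<le> b \<and> k * v s > 0"
  proof (rule ccontr)
    assume "\<not> ?thesis"
    then have neg: "0 \<le> - k * v s" if "a \<le> s" "s \<le> b" for s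
      using that by (auto simp: not_less)
    have "0 \<le> - k * d * (exp (c / d) * u c - exp (a / d) * u a)"
      by (rule exp_primitive_mono[OF assms(1) \<open>a \<le> c\<close>]) (use neg assms in auto)
    moreover have "0 \<le> - k * d * (exp (b / d) * u b - exp (c / d) * u c)"
      by (rule exp_primitive_mono[OF assms(1) \<open>c \<le> b\<close>]) (use neg assms in auto)
    ultimately have "k * d * exp (c / d) * u c = 0" using assms by (simp add: mult.assoc)
    then show False using assms by simp
  qed
  then show ?thesis using that by blast
qed

text \<open>By right continuity \<open>v\<close> stays close to \<open>v x\<close> just after
  \<open>x\<close>, whereas the integral of \<open>exp (s / d) * v s\<close> over that stretch is 0.
  This reaches every point, including those where \<open>v\<close> jumps.\<close>

lemma exp_primitive_eq_0:
  assumes P: "exp_primitive d v u" and cont: "\<And>x. continuous (at_right x) v"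
    and z: "\<And>s. a \<le> s \<Longrightarrow> s < b \<Longrightarrow> u s = 0" and x: "a \<le> x" "x < b"
  shows "v x = 0"
proof (rule ccontr)
  assume nz: "v x \<noteq> 0"
  have "(v \<longlongrightarrow> v x) (at_right x)" using cont by (simp add: continuous_within)
  then have "\<forall>\<^sub>F s in at_right x. \<bar>v s - v x\<bar> < \<bar>v x\<bar> / 2"
    using nz by (auto dest!: tendstoD[where e = "\<bar>v x\<bar> / 2"] simp: dist_real_def)
  then obtain e where e: "e > x" "\<And>s. x < s \<Longrightarrow> s < e \<Longrightarrow> \<bar>v s - v x\<bar> < \<bar>v x\<bar> / 2"
    unfolding eventually_at_right_field by blast
  define c where "c = (x + min e b) / 2"
  have c: "x < c" "c < e" "c < b" using e x by (auto simp: c_def min_def field_simps)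
  \<comment> \<open>A lower bound for \<open>v x * (exp (s / d) * v s)\<close> on [x, c]: there
    \<open>v x * v s\<close> is at least half of \<open>(v x)\<^sup>2\<close>, and the smaller
    endpoint value bounds the exponential whichever sign \<open>d\<close> has.\<close>
  define \<mu> where "\<mu> = min (exp (x / d)) (exp (c / d)) * (v x)\<^sup>2 / 2"
  have "\<mu> > 0" using nz by (simp add: \<mu>_def)
  have "((\<lambda>s. v x * (exp (s / d) * v s)) has_integral
      v x * (d * (exp (c / d) * u c - exp (x / d) * u x))) {x..c}"
    using P c unfolding exp_primitive_def by (intro has_integral_mult_right) auto
  then have int0: "((\<lambda>s. v x * (exp (s / d) * v s)) has_integral 0) {x..c}"
    using z c x by auto
  have "((\<lambda>s. \<mu>) has_integral (c - x) * \<mu>) {x..c}"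
    using has_integral_const_real[of \<mu> x c] c by simp
  then have "(c - x) * \<mu> \<le> 0"
  proof (rule has_integral_le[OF _ int0])
    fix s assume s: "s \<in> {x..c}"
    have "\<bar>v s - v x\<bar> \<le> \<bar>v x\<bar> / 2" using e(2)[of s] s c by (cases "s = x") auto
    then have "(v x)\<^sup>2 / 2 \<le> v x * v s"
    proof -
      have "\<bar>v x * (v s - v x)\<bar> \<le> \<bar>v x\<bar> * (\<bar>v x\<bar> / 2)"
        unfolding abs_mult using \<open>\<bar>v s - v x\<bar> \<le> \<bar>v x\<bar> / 2\<close> by (intro mult_left_mono) auto
      then have "- (v x * (v s - v x)) \<le> \<bar>v x\<bar> * (\<bar>v x\<bar> / 2)" by linarith
      then show ?thesis by (simp add: power2_eq_square algebra_simps)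
    qed
    moreover have "min (exp (x / d)) (exp (c / d)) \<le> exp (s / d)"
      using s by (cases "d > 0") (auto simp: min_le_iff_disj divide_right_mono divide_right_mono_neg)
    ultimately have "min (exp (x / d)) (exp (c / d)) * ((v x)\<^sup>2 / 2) \<le> exp (s / d) * (v x * v s)"
      by (intro mult_mono) auto
    then show "\<mu> \<le> v x * (exp (s / d) * v s)" by (simp add: \<mu>_def mult_ac)
  qed
  then show False using \<open>\<mu> > 0\<close> c by (simp add: mult_le_0_iff)
qed

section \<open>Counting sign changes\<close>

definition alternates :: "(real \<Rightarrow> real) \<Rightarrow> nat \<Rightarrow> real \<Rightarrow> real \<Rightarrow> bool" where
  "alternates f N a b \<longleftrightarrow> (\<exists>t k. k \<noteq> 0 \<and> (\<forall>i\<le>N. a \<le> t i \<and> t i \<le> b \<and> k * (-1) ^ i * f (t i) > (0::real)) \<and>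
     (\<forall>i<N. t i < t (Suc i)))"

text \<open>Weakly ordered points suffice, since neighbours with opposite strict signs cannot
  coincide. This suits witnesses taken from adjacent closed intervals.\<close>

lemma alternatesI:
  assumes "k \<noteq> 0" "\<And>i. i \<le> N \<Longrightarrow> a \<le> t i \<and> t i \<le> b \<and> k * (-1) ^ i * f (t i) > 0"
    and "\<And>i. i < N \<Longrightarrow> t i \<le> t (Suc i)"
  shows "alternates f N a b"
proof -
  have "t i < t (Suc i)" if "i < N" for i
  proof -
    have "t i \<noteq> t (Suc i)" using assms(2)[of i] assms(2)[of "Suc i"] that by auto
    then show ?thesis using assms(3)[OF that] by simp
  qed
  then show ?thesis using assms(1,2) unfolding alternates_def by blast
qed

text \<open>Between two points where \<open>u\<close> has opposite signs the weighted function
  strictly rises or falls, so \<open>d * v\<close> takes the matching sign in between: each order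
  costs one sign change. The new factor \<open>- d * k\<close> absorbs the sign of
  \<open>d\<close>.\<close>

lemma alternates_exp_primitive:
  assumes P: "exp_primitive d v u" and d: "d \<noteq> 0" and alt: "alternates u (Suc N) a b"
  shows "alternates v N a b"
proof -
  obtain t k where k: "k \<noteq> 0" and t: "\<And>i. i \<le> Suc N \<Longrightarrow> a \<le> t i \<and> t i \<le> b \<and> k * (-1) ^ i * u (t i) > 0"
    and lt: "\<And>i. i < Suc N \<Longrightarrow> t i < t (Suc i)"
    using alt unfolding alternates_def by blast
  have "\<exists>s. t i \<le> s \<and> s \<le> t (Suc i) \<and> (- d * k) * (-1) ^ i * v s > 0" if i: "i \<le> N" for i
  proof (rule ccontr)
    assume "\<not> ?thesis"
    then have neg: "0 \<le> (d * k * (-1) ^ i) * v s" if "t i \<le> s" "s \<le> t (Suc i)" for s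
      using that by (auto simp: not_less)
    have "0 \<le> (d * k * (-1) ^ i) * d * (exp (t (Suc i) / d) * u (t (Suc i)) - exp (t i / d) * u (t i))"
      by (rule exp_primitive_mono[OF P]) (use neg lt[of i] i in auto)
    also have "\<dots> = - (d\<^sup>2) * (exp (t (Suc i) / d) * (k * (-1) ^ Suc i * u (t (Suc i)))
        + exp (t i / d) * (k * (-1) ^ i * u (t i)))"
      by (simp add: power2_eq_square algebra_simps)
    also have "\<dots> < 0"
    proof -
      have "0 < exp (t (Suc i) / d) * (k * (-1) ^ Suc i * u (t (Suc i)))"
        using t[of "Suc i"] i by (intro mult_pos_pos[OF exp_gt_zero]) auto
      moreover have "0 < exp (t i / d) * (k * (-1) ^ i * u (t i))"
        using t[of i] i by (intro mult_pos_pos[OF exp_gt_zero]) auto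
      moreover have "0 < d\<^sup>2" using d by simp
      ultimately show ?thesis
        by (metis add_pos_pos mult_minus_left mult_pos_pos neg_less_0_iff_less)
    qed
    finally show False by simp
  qed
  then obtain s where s: "\<And>i. i \<le> N \<Longrightarrow> t i \<le> s i \<and> s i \<le> t (Suc i) \<and> (- d * k) * (-1) ^ i * v (s i) > 0"
    by metis
  show ?thesis
  proof (rule alternatesI)
    show "- d * k \<noteq> 0" using d k by simp
    show "a \<le> s i \<and> s i \<le> b \<and> - d * k * (-1) ^ i * v (s i) > 0" if "i \<le> N" for i
      using s[OF that] t[of i] t[of "Suc i"] that by auto
    show "s i \<le> s (Suc i)" if "i < N" for i
      using s[of i] s[of "Suc i"] that by auto
  qed
qed

text \<open>The function \<open>u i\<close> is an exponential spline of order \<open>i + 1\<close> with knots in \<open>n + q\<int>\<close>.\<close>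

locale exp_spline =
  fixes \<delta> :: "nat \<Rightarrow> real" and u :: "nat \<Rightarrow> real \<Rightarrow> real" and n q :: real
  assumes delta_nz: "\<And>i. \<delta> i \<noteq> 0"
    and prim: "\<And>i. exp_primitive (\<delta> (Suc i)) (u i) (u (Suc i))"
    and q_pos: "q > 0"
    and piece: "\<And>x y. \<lfloor>(x - n) / q\<rfloor> = \<lfloor>(y - n) / q\<rfloor> \<Longrightarrow> u 0 y = exp ((x - y) / \<delta> 0) * u 0 x"
begin

lemma floor_eqI:
  assumes "n + q * of_int j \<le> x" "x < n + q * (of_int j + 1)"
  shows "\<lfloor>(x - n) / q\<rfloor> = j"
  using assms q_pos by (intro floor_unique) (auto simp: field_simps)

lemma floor_bounds:
  shows "n + q * of_int \<lfloor>(x - n) / q\<rfloor> \<le> x" "x < n + q * (of_int \<lfloor>(x - n) / q\<rfloor> + 1)"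
proof -
  have "of_int \<lfloor>(x - n) / q\<rfloor> \<le> (x - n) / q" "(x - n) / q < of_int \<lfloor>(x - n) / q\<rfloor> + 1"
    by linarith+
  then have "of_int \<lfloor>(x - n) / q\<rfloor> * q \<le> x - n" "x - n < (of_int \<lfloor>(x - n) / q\<rfloor> + 1) * q"
    using q_pos by (simp_all only: pos_le_divide_eq pos_divide_less_eq)
  then show "n + q * of_int \<lfloor>(x - n) / q\<rfloor> \<le> x" "x < n + q * (of_int \<lfloor>(x - n) / q\<rfloor> + 1)"
    by (simp_all add: algebra_simps)
qed

lemma continuous_on_Suc: "continuous_on UNIV (u (Suc i))"
  using exp_primitive_continuous[OF prim delta_nz] .

text \<open>For \<open>i = 0\<close> the pieces live on cells closed on the left, so right limits
  are attained even at knots; higher orders are continuous. The descent of zeros through the orders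
  rests on this.\<close>

lemma continuous_at_right: "continuous (at_right x) (u i)"
proof (cases i)
  case (Suc k)
  then have "isCont (u i) x" using continuous_on_Suc by (simp add: continuous_on_eq_continuous_at)
  then show ?thesis by (rule continuous_at_imp_continuous_within)
next
  case 0
  define j where "j = \<lfloor>(x - n) / q\<rfloor>"
  define e where "e = n + q * (of_int j + 1)"
  have x: "n + q * of_int j \<le> x" "x < e" unfolding j_def e_def by (rule floor_bounds)+
  have "((\<lambda>y. exp ((x - y) / \<delta> 0) * u 0 x) \<longlongrightarrow> exp ((x - x) / \<delta> 0) * u 0 x) (at_right x)"
    using delta_nz by (intro tendsto_intros) auto
  moreover have "\<forall>\<^sub>F y in at_right x. exp ((x - y) / \<delta> 0) * u 0 x = u 0 y"
    unfolding eventually_at_right_field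
  proof (intro exI conjI allI impI)
    show "x < e" by fact
    fix y assume y: "y > x" "y < e"
    have "\<lfloor>(y - n) / q\<rfloor> = j" using x y by (intro floor_eqI) (auto simp: e_def)
    then show "exp ((x - y) / \<delta> 0) * u 0 x = u 0 y" using piece[of x y] by (simp add: j_def)
  qed
  ultimately have "(u 0 \<longlongrightarrow> exp ((x - x) / \<delta> 0) * u 0 x) (at_right x)"
    by (rule Lim_transform_eventually)
  then show ?thesis by (simp add: continuous_within 0)
qed

lemma zero_descends:
  assumes "\<And>s. a \<le> s \<Longrightarrow> s < b \<Longrightarrow> u i s = 0" "k \<le> i" "a \<le> s" "s < b"
  shows "u k s = 0"
  using assms(2,3,4)
proof (induction k arbitrary: s rule: inc_induct)
  case base then show ?case using assms(1) by simp
next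
  case (step k)
  show ?case
    by (rule exp_primitive_eq_0[OF prim[of k] continuous_at_right, of a b])
       (use step in auto)
qed

lemma zero_at_right_end:
  assumes "\<And>s. a \<le> s \<Longrightarrow> s < b \<Longrightarrow> u (Suc i) s = 0" "a < b"
  shows "u (Suc i) b = 0"
proof -
  have "isCont (u (Suc i)) b" using continuous_on_Suc by (simp add: continuous_on_eq_continuous_at)
  then have 1: "(u (Suc i) \<longlongrightarrow> u (Suc i) b) (at_left b)"
    by (simp add: continuous_at tendsto_within_subset[of _ _ _ UNIV])
  have "\<forall>\<^sub>F s in at_left b. u (Suc i) s = 0"
    unfolding eventually_at_left_field using assms by (intro exI[of _ a]) auto
  then have 2: "(u (Suc i) \<longlongrightarrow> 0) (at_left b)" by (rule tendsto_eventually)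
  show ?thesis by (rule tendsto_unique[OF _ 1 2]) simp
qed

text \<open>If a knot lies in (s, s'], the cell of \<open>s\<close> begins at least \<open>q\<close>
  before \<open>s'\<close>, hence before \<open>b\<close>, and so meets the interval of zeros; its
  piece is then 0. Without such a knot both values have the same sign.\<close>

lemma weak_sign_bottom:
  assumes "\<And>s. a \<le> s \<Longrightarrow> s < b \<Longrightarrow> u 0 s = 0" "a < b" "c < b + q"
  obtains k where "k \<noteq> 0" "\<And>s. b \<le> s \<Longrightarrow> s < c \<Longrightarrow> 0 \<le> k * u 0 s"
proof -
  have same: "0 \<le> u 0 s * u 0 s'" if s: "b \<le> s" "s \<le> s'" "s' < c" for s s'
  proof (cases "\<lfloor>(s - n) / q\<rfloor> = \<lfloor>(s' - n) / q\<rfloor>")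
    case True
    have "u 0 s * u 0 s' = exp ((s - s') / \<delta> 0) * (u 0 s * u 0 s)" using piece[OF True] by simp
    then show ?thesis by (simp only: zero_le_mult_iff[of "exp _"]) simp
  next
    case False
    define J J' where "J = \<lfloor>(s - n) / q\<rfloor>" and "J' = \<lfloor>(s' - n) / q\<rfloor>"
    have "J \<le> J'" unfolding J_def J'_def using s q_pos by (intro floor_mono divide_right_mono) auto
    then have "J + 1 \<le> J'" using False by (simp add: J_def J'_def)
    then have "q * (of_int J + 1) \<le> q * of_int J'" using q_pos
      by (intro mult_left_mono) (auto simp del: of_int_add simp: of_int_add[symmetric] of_int_le_iff
          intro: order_trans[OF _ of_int_le_iff[THEN iffD2]])
    moreover have "n + q * of_int J' \<le> s'" unfolding J'_def by (rule floor_bounds)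
    ultimately have J: "n + q * of_int J < b" using s assms(3) by (simp add: algebra_simps)
    have sJ: "s < n + q * (of_int J + 1)" unfolding J_def by (rule floor_bounds)
    \<comment> \<open>A point both in [a, b) and in the cell of \<open>s\<close>; it transports the
      zero to \<open>s\<close>.\<close>
    define r where "r = (max a (n + q * of_int J) + b) / 2"
    have r: "a \<le> r" "r < b" "n + q * of_int J \<le> r" using J assms(2) by (auto simp: r_def max_def field_simps)
    have "\<lfloor>(r - n) / q\<rfloor> = J" using r sJ s by (intro floor_eqI) auto
    then have "u 0 s = exp ((r - s) / \<delta> 0) * u 0 r" by (intro piece) (simp add: J_def)
    then show ?thesis using assms(1)[OF r(1,2)] by simp
  qed
  show ?thesis
  proof (cases "\<exists>s. b \<le> s \<and> s < c \<and> u 0 s \<noteq> 0")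
    case True
    then obtain s where "b \<le> s" "s < c" "u 0 s \<noteq> 0" by blast
    then show ?thesis using same by (intro that[of "u 0 s"]) (metis linear mult.commute)+
  next
    case False
    then show ?thesis by (intro that[of 1]) auto
  qed
qed

text \<open>Starting from 0 at \<open>b\<close>, the weighted function moves monotonically in the
  direction given by \<open>k * \<delta> (Suc i)\<close>; a second zero at \<open>c\<close> pins it
  to 0 in between.\<close>

lemma weak_sign_step:
  assumes "k \<noteq> 0" "\<And>s. b \<le> s \<Longrightarrow> s < c \<Longrightarrow> 0 \<le> k * u i s" "u (Suc i) b = 0"
  shows "\<And>s. b \<le> s \<Longrightarrow> s \<le> c \<Longrightarrow> 0 \<le> k * \<delta> (Suc i) * u (Suc i) s"
    and "u (Suc i) c = 0 \<Longrightarrow> b \<le> s \<Longrightarrow> s \<le> c \<Longrightarrow> u (Suc i) s = 0"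
proof -
  let ?F = "\<lambda>s. exp (s / \<delta> (Suc i)) * u (Suc i) s"
  have mono: "0 \<le> k * \<delta> (Suc i) * (?F t - ?F s)" if "b \<le> s" "s \<le> t" "t \<le> c" for s t
    by (rule exp_primitive_mono[OF prim]) (use that assms in auto)
  have nn: "0 \<le> k * \<delta> (Suc i) * u (Suc i) s" if "b \<le> s" "s \<le> c" for s
  proof -
    have "0 \<le> exp (s / \<delta> (Suc i)) * (k * \<delta> (Suc i) * u (Suc i) s)"
      using mono[of b s] that assms(3) by (simp add: mult_ac)
    then show ?thesis by (simp only: zero_le_mult_iff[of "exp _"]) simp
  qed
  then show "\<And>s. b \<le> s \<Longrightarrow> s \<le> c \<Longrightarrow> 0 \<le> k * \<delta> (Suc i) * u (Suc i) s" .
  show "u (Suc i) s = 0" if "u (Suc i) c = 0" "b \<le> s" "s \<le> c"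
  proof -
    have "exp (s / \<delta> (Suc i)) * (k * \<delta> (Suc i) * u (Suc i) s) \<le> 0"
      using mono[of s c] that by (simp add: mult_ac)
    then have "k * \<delta> (Suc i) * u (Suc i) s \<le> 0"
      by (simp only: mult_le_0_iff[of "exp _"]) simp
    then have "k * \<delta> (Suc i) * u (Suc i) s = 0" using nn that by (intro antisym) auto
    then show ?thesis using assms(1) delta_nz by simp
  qed
qed

text \<open>Since \<open>c < b + q\<close>, at most one knot lies in \<open>[b, c)\<close>. So \<open>u 0\<close> does not change sign there,
  and integrating up from zero data at \<open>b\<close> preserves weak signs.\<close>

lemma zero_propagates:
  assumes z: "\<And>s. a \<le> s \<Longrightarrow> s < b \<Longrightarrow> u (Suc i) s = 0" and "a < b" "c < b + q" "u (Suc i) c = 0"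
    and "a \<le> s" "s < c"
  shows "u (Suc i) s = 0"
proof (cases "s < b")
  case True then show ?thesis using z \<open>a \<le> s\<close> by auto
next
  case False
  \<comment> \<open>Zero initial data at \<open>b\<close> for the positive orders, by continuity.
    Order zero may jump at \<open>b\<close>, so it enters only through its weak sign.\<close>
  have zb: "u (Suc k) b = 0" if "k \<le> i" for k
  proof (rule zero_at_right_end)
    show "u (Suc k) s = 0" if "a \<le> s" "s < b" for s
      using zero_descends[of a b "Suc i" "Suc k" s] z that \<open>k \<le> i\<close> by auto
  qed fact
  have "\<exists>k. k \<noteq> 0 \<and> (\<forall>s. b \<le> s \<and> s < c \<longrightarrow> 0 \<le> k * u j s)" if "j \<le> i" for j
    using that
  proof (induction j)
    case 0
    have "u 0 s = 0" if "a \<le> s" "s < b" for s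
      using zero_descends[of a b "Suc i" 0 s] z that by auto
    then show ?case using weak_sign_bottom[of a b c] \<open>a < b\<close> \<open>c < b + q\<close> by metis
  next
    case (Suc j)
    then obtain k where k: "k \<noteq> 0" "\<And>s. b \<le> s \<Longrightarrow> s < c \<Longrightarrow> 0 \<le> k * u j s" by auto
    show ?case using weak_sign_step(1)[OF k zb] Suc.prems k(1) delta_nz
      by (intro exI[of _ "k * \<delta> (Suc j)"]) auto
  qed
  then obtain k where k: "k \<noteq> 0" "\<And>s. b \<le> s \<Longrightarrow> s < c \<Longrightarrow> 0 \<le> k * u i s" by blast
  show ?thesis using weak_sign_step(2)[OF k zb \<open>u (Suc i) c = 0\<close>] False \<open>s < c\<close> by auto
qed

text \<open>The pieces have constant sign, so the \<open>N + 1\<close> points lie in distinct cells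
  and the outer cell indices differ by at least \<open>N\<close>. Both outer points may sit near the
  inner ends of their cells, so only \<open>N - 1\<close> full cells are guaranteed between
  them.\<close>

lemma alternates_bottom:
  assumes "alternates (u 0) N a b"
  shows "(real N - 1) * q < b - a"
proof -
  obtain t k where k: "k \<noteq> 0" and t: "\<And>i. i \<le> N \<Longrightarrow> a \<le> t i \<and> t i \<le> b \<and> k * (-1) ^ i * u 0 (t i) > 0"
    and lt: "\<And>i. i < N \<Longrightarrow> t i < t (Suc i)"
    using assms unfolding alternates_def by blast
  define J where "J = (\<lambda>i. \<lfloor>(t i - n) / q\<rfloor>)"
  have J: "J 0 + int i \<le> J i" if "i \<le> N" for i
    using that
  proof (induction i)
    case (Suc i)
    have "J i \<le> J (Suc i)" unfolding J_def using lt[of i] Suc.prems q_pos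
      by (intro floor_mono divide_right_mono) auto
    moreover have "J i \<noteq> J (Suc i)"
    proof
      assume "J i = J (Suc i)"
      then have "u 0 (t (Suc i)) = exp ((t i - t (Suc i)) / \<delta> 0) * u 0 (t i)"
        unfolding J_def by (rule piece)
      then have "0 < - (exp ((t i - t (Suc i)) / \<delta> 0) * (k * (-1) ^ i * u 0 (t i)))"
        using t[of "Suc i"] Suc.prems by (simp add: mult_ac)
      moreover have "0 < exp ((t i - t (Suc i)) / \<delta> 0) * (k * (-1) ^ i * u 0 (t i))"
        using t[of i] Suc.prems by (intro mult_pos_pos[OF exp_gt_zero]) auto
      ultimately show False by simp
    qed
    ultimately show ?case using Suc by auto
  qed simp
  have "n + q * of_int (J N) \<le> t N" unfolding J_def by (rule floor_bounds)
  moreover have "t 0 < n + q * (of_int (J 0) + 1)" unfolding J_def by (rule floor_bounds)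
  moreover have "q * (of_int (J 0) + real N) \<le> q * of_int (J N)"
  proof -
    have "of_int (J 0 + int N) \<le> (of_int (J N) :: real)" using J[of N] by (simp only: of_int_le_iff)
    then show ?thesis using q_pos by simp
  qed
  moreover have "t N \<le> b" "a \<le> t 0" using t by auto
  ultimately show ?thesis by (simp add: algebra_simps)
qed

lemma alternates_descends:
  assumes "alternates (u i) (N + i) a b"
  shows "alternates (u 0) N a b"
  using assms
proof (induction i)
  case (Suc i)
  then show ?case using alternates_exp_primitive[OF prim delta_nz, of i "N + i" a b] by simp
qed simp

text \<open>Otherwise Rolle's theorem, applied once per order, leaves about \<open>N - i\<close> sign changes of \<open>u 0\<close>;
  two consecutive ones are separated by a knot, but there are only about \<open>N p / q\<close> knots.\<close>

lemma exists_zero_interval: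
  assumes "p > 0" "p < q" and z: "\<And>k. k \<le> N \<Longrightarrow> u (Suc i) (A + real k * p) = 0"
    and N: "real (i + 2) * q \<le> real N * (q - p)"
  obtains k where "k < N" "\<And>s. A + real k * p \<le> s \<Longrightarrow> s < A + real (Suc k) * p \<Longrightarrow> u (Suc i) s = 0"
proof -
  have "\<exists>k<N. \<forall>s. A + real k * p \<le> s \<and> s < A + real (Suc k) * p \<longrightarrow> u (Suc i) s = 0"
  proof (rule ccontr)
    assume "\<not> ?thesis"
    then have ex: "\<exists>s. A + real k * p \<le> s \<and> s < A + real (Suc k) * p \<and> u (Suc i) s \<noteq> 0" if "k < N" for k
      using that by auto
    \<comment> \<open>Each gap has a nonzero value between two zeros, so both signs of
      \<open>u i\<close> occur there and the sign (-1)^k can be imposed.\<close>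
    have "\<exists>s. A + real k * p \<le> s \<and> s \<le> A + real (Suc k) * p \<and> (-1) ^ k * u i s > 0" if "k < N" for k
    proof -
      obtain c where c: "A + real k * p \<le> c" "c < A + real (Suc k) * p" "u (Suc i) c \<noteq> 0"
        using ex[OF \<open>k < N\<close>] by blast
      show ?thesis
        by (rule exp_primitive_signs[OF prim delta_nz, of i "A + real k * p" "A + real (Suc k) * p" c "(-1) ^ k"])
           (use c z[of k] z[of "Suc k"] that in auto)
    qed
    then obtain s where s: "\<And>k. k < N \<Longrightarrow>
        A + real k * p \<le> s k \<and> s k \<le> A + real (Suc k) * p \<and> (-1) ^ k * u i (s k) > 0"
      by metis
    have "real (i + 2) * q \<le> real N * q - real N * p" using N by (simp add: algebra_simps)
    moreover have "0 \<le> real N * p" using \<open>p > 0\<close> by simp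
    ultimately have "real (i + 2) * q \<le> real N * q" by linarith
    then have iN: "i + 2 \<le> N" using q_pos by simp
    \<comment> \<open>\<open>N\<close> gaps give \<open>N - 1\<close> sign changes of
      \<open>u i\<close>, of which \<open>N - 1 - i\<close> survive for \<open>u 0\<close>. They
      would force (N - 2 - i) q < N p, the exact negation of the hypothesis on
      \<open>N\<close>.\<close>
    have "alternates (u i) ((N - 1 - i) + i) A (A + real N * p)"
    proof (rule alternatesI[where k = 1 and t = s])
      fix k assume "k \<le> N - 1 - i + i"
      then have k: "k < N" using iN by auto
      have "real (Suc k) * p \<le> real N * p" using k \<open>p > 0\<close> by (intro mult_right_mono) auto
      then show "A \<le> s k \<and> s k \<le> A + real N * p \<and> 0 < 1 * (-1) ^ k * u i (s k)"
        using s[OF k] mult_nonneg_nonneg[of "real k" p] \<open>p > 0\<close>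
        by (intro conjI) (linarith | simp)+
    next
      fix k assume "k < N - 1 - i + i"
      then have "k < N" "Suc k < N" using iN by auto
      then show "s k \<le> s (Suc k)" using s[of k] s[of "Suc k"] by auto
    qed simp
    then have "(real (N - 1 - i) - 1) * q < real N * p"
      using alternates_bottom[OF alternates_descends] by fastforce
    then have "(real N - real (i + 2)) * q < real N * p" using iN by (simp add: algebra_simps)
    then show False using N by (simp add: algebra_simps)
  qed
  then show ?thesis using that by blast
qed

text \<open>The first \<open>N\<close> gaps serve only to find one gap of zeros, whose position is
  not controlled. From its right end each further zero lies less than \<open>q\<close> ahead, so the
  zero set grows gap by gap and covers all gaps after the first \<open>N\<close>, wherever the
  search ended.\<close>

theorem zeros_force_vanishing:
  assumes "p > 0" "p < q" and z: "\<And>k. k \<le> N + R \<Longrightarrow> u (Suc i) (A + real k * p) = 0"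
    and N: "real (i + 2) * q \<le> real N * (q - p)"
    and s: "A + real N * p \<le> s" "s < A + real (N + R) * p"
  shows "u 0 s = 0"
proof -
  obtain k where k: "k < N" "\<And>s. A + real k * p \<le> s \<Longrightarrow> s < A + real (Suc k) * p \<Longrightarrow> u (Suc i) s = 0"
    by (rule exists_zero_interval[of p N i A]) (use assms in auto)
  have "u (Suc i) s = 0" if "A + real k * p \<le> s" "s < A + real (Suc k + r) * p" "Suc k + r \<le> N + R" for r s
    using that
  proof (induction r arbitrary: s)
    case 0 then show ?case using k(2) by simp
  next
    case (Suc r)
    show ?case
    proof (rule zero_propagates[of "A + real k * p" "A + real (Suc k + r) * p" i "A + real (Suc k + Suc r) * p"])
      show "A + real k * p < A + real (Suc k + r) * p" using \<open>p > 0\<close> by simp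
      show "A + real (Suc k + Suc r) * p < A + real (Suc k + r) * p + q" using \<open>p < q\<close> by (simp add: algebra_simps)
      show "u (Suc i) (A + real (Suc k + Suc r) * p) = 0" using z Suc.prems by blast
    qed (use Suc in auto)
  qed
  from this[of _ "N + R - Suc k"] have *: "u (Suc i) s = 0" if "A + real k * p \<le> s" "s < A + real (N + R) * p" for s
    using k(1) that by auto
  have "A + real k * p \<le> s" using s(1) k(1) \<open>p > 0\<close>
    by (intro order_trans[OF _ s(1)]) auto
  then show ?thesis
    using zero_descends[of "A + real k * p" "A + real (N + R) * p" "Suc i" 0 s] * s by auto
qed

end

section \<open>Totally positive kernels\<close>

lemma integrable_exponential_density:
  assumes "l > 0"
  shows "integrable lborel (exponential_density l)" "integral\<^sup>L lborel (exponential_density l) = 1"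
proof -
  interpret prob_space "density lborel (exponential_density l)"
    using assms by (rule prob_space_exponential_density)
  have nn: "AE x in lborel. 0 \<le> exponential_density l x" using assms by (simp add: exponential_density_nonneg)
  have "(\<integral>\<^sup>+x. ennreal (exponential_density l x) \<partial>lborel) = ennreal 1"
    using emeasure_space_1 by (simp add: emeasure_density)
  then have "has_bochner_integral lborel (exponential_density l) 1"
    using nn by (intro has_bochner_integral_nn_integral) auto
  then show "integrable lborel (exponential_density l)" "integral\<^sup>L lborel (exponential_density l) = 1"
    by (auto simp: has_bochner_integral_iff)
qed

lemma exponential_density_char:
  "(LINT t|lborel. complex_of_real (exponential_density 1 t) * exp (- (\<i> * complex_of_real (w * t))))
     = inverse (1 + \<i> * complex_of_real w)"
proof -
  define f where "f = (\<lambda>t. exp (- ((1 + \<i> * complex_of_real w) * complex_of_real t)))"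
  define F where "F = (\<lambda>t. - inverse (1 + \<i> * complex_of_real w) * f t)"
  have nz: "1 + \<i> * complex_of_real w \<noteq> 0" by (auto simp: complex_eq_iff)
  have eq: "complex_of_real (exponential_density 1 t) * exp (- (\<i> * complex_of_real (w * t))) = indicator {0..} t *\<^sub>R f t" for t
  proof -
    have "f t = complex_of_real (exp (- t)) * exp (- (\<i> * complex_of_real (w * t)))"
      unfolding f_def exp_of_real[symmetric] exp_add[symmetric] by (simp add: algebra_simps)
    then show ?thesis by (simp add: exponential_density_def indicator_def)
  qed
  have nf: "norm (f t) = exp (- t)" for t by (simp add: f_def)
  have int: "integrable lborel (\<lambda>t. indicator {0..} t *\<^sub>R f t)"
  proof (rule Bochner_Integration.integrable_bound[OF integrable_exponential_density(1)[of 1]])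
    show "(\<lambda>t. indicator {0..} t *\<^sub>R f t) \<in> borel_measurable lborel"
      unfolding f_def by measurable
    show "AE t in lborel. norm (indicator {0..} t *\<^sub>R f t) \<le> norm (exponential_density 1 t)"
      by (auto simp: nf exponential_density_def indicator_def)
  qed simp
  have "(LBINT t=ereal 0..\<infinity>. f t) = 0 - F 0"
  proof (rule interval_integral_FTC_integrable)
    show "(F has_vector_derivative f t) (at t)" for t
    proof -
      let ?z = "1 + \<i> * complex_of_real w"
      have "((\<lambda>z. - inverse ?z * exp (- (?z * z))) has_field_derivative - inverse ?z * (exp (- (?z * of_real t)) * - ?z)) (at (of_real t))"
        by (auto intro!: derivative_eq_intros)
      then have "((\<lambda>t. - inverse ?z * exp (- (?z * of_real t))) has_vector_derivative - inverse ?z * (exp (- (?z * of_real t)) * - ?z)) (at t)"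
        by (rule has_vector_derivative_real_field)
      moreover have "- inverse ?z * (exp (- (?z * of_real t)) * - ?z) = f t" using nz unfolding f_def
        by (simp only: mult_minus_left mult_minus_right minus_minus) (simp del: minus_add_distrib)
      ultimately show ?thesis unfolding F_def f_def by simp
    qed
    show "isCont f t" for t unfolding f_def by (intro continuous_intros)
    have "set_integrable lborel {0..} f" using int by (simp add: set_integrable_def)
    then show "set_integrable lborel (einterval (ereal 0) \<infinity>) f"
      by (rule set_integrable_subset) (auto simp: einterval_def)
    have "isCont F 0" unfolding F_def f_def by (intro continuous_intros)
    then show "((F \<circ> real_of_ereal) \<longlongrightarrow> F 0) (at_right (ereal 0))"
      by (simp add: ereal_tendsto_simps1 isCont_def filterlim_at_split del: zero_ereal_def)
    have "((\<lambda>t. exp (- t)) \<longlongrightarrow> (0::real)) at_top" by real_asymp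
    then have "(f \<longlongrightarrow> 0) at_top" by (intro Lim_null_comparison[of f]) (auto simp: nf)
    then have "(F \<longlongrightarrow> - inverse (1 + \<i> * complex_of_real w) * 0) at_top"
      unfolding F_def by (intro tendsto_intros)
    then show "((F \<circ> real_of_ereal) \<longlongrightarrow> 0) (at_left \<infinity>)"
      by (simp add: ereal_tendsto_simps1)
  qed simp
  also have "\<dots> = inverse (1 + \<i> * complex_of_real w)" by (simp add: F_def f_def)
  also have "(LBINT t=ereal 0..\<infinity>. f t) = (LINT t:{0<..}|lborel. f t)"
    by (simp add: interval_integral_to_infinity_eq)
  also have "\<dots> = (LINT t|lborel. indicator {0..} t *\<^sub>R f t)"
    unfolding set_lebesgue_integral_def
    by (rule integral_cong_AE) (auto simp: f_def indicator_def intro: AE_mp[OF AE_lborel_singleton[of 0]])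
  finally show ?thesis unfolding eq .
qed

text \<open>Convolution with the density of \<open>d\<close> times a standard exponential variable,
  which solves u + d u' = h. Integrating over \<open>t\<close> instead of over the shift
  \<open>d * t\<close> treats both signs of \<open>d\<close> alike.\<close>

definition exp_smooth :: "real \<Rightarrow> (real \<Rightarrow> real) \<Rightarrow> real \<Rightarrow> real" where
  "exp_smooth d h x = (LINT t|lborel. exponential_density 1 t * h (x - d * t))"

definition exp_decay :: "real \<Rightarrow> (real \<Rightarrow> real) \<Rightarrow> bool" where
  "exp_decay \<beta> h \<longleftrightarrow> h \<in> borel_measurable borel \<and> (\<exists>A\<ge>0. \<forall>x. \<bar>h x\<bar> \<le> A * exp (- \<beta> * \<bar>x\<bar>))"

lemma exp_decayE:
  assumes "exp_decay \<beta> h"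
  obtains A where "A \<ge> 0" "\<And>x. \<bar>h x\<bar> \<le> A * exp (- \<beta> * \<bar>x\<bar>)"
  using assms unfolding exp_decay_def by blast

lemma exp_decay_measurable[measurable_dest]: "exp_decay \<beta> h \<Longrightarrow> h \<in> borel_measurable borel"
  by (simp add: exp_decay_def)

lemma exp_decay_bounded:
  assumes "exp_decay \<beta> h" "\<beta> > 0"
  obtains A where "A \<ge> 0" "\<And>x. \<bar>h x\<bar> \<le> A"
proof -
  obtain A where A: "A \<ge> 0" "\<And>x. \<bar>h x\<bar> \<le> A * exp (- \<beta> * \<bar>x\<bar>)" using exp_decayE[OF assms(1)] by blast
  have "\<bar>h x\<bar> \<le> A" for x
    using A(2)[of x] mult_left_mono[of "exp (- \<beta> * \<bar>x\<bar>)" 1 A] A(1) assms(2) by simp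
  with A(1) show ?thesis using that by blast
qed

lemma exp_decay_integrable:
  assumes "exp_decay \<beta> h" "\<beta> > 0"
  shows "integrable lborel h"
proof -
  note [measurable] = exp_decay_measurable[OF assms(1)]
  obtain A where A: "A \<ge> 0" "\<And>x. \<bar>h x\<bar> \<le> A * exp (- \<beta> * \<bar>x\<bar>)" using exp_decayE[OF assms(1)] by blast
  have "integrable lborel (\<lambda>x. A / \<beta> * (exponential_density \<beta> x + exponential_density \<beta> (0 + (-1) * x)))"
    using integrable_exponential_density[OF assms(2)]
    by (intro integrable_mult_right Bochner_Integration.integrable_add lborel_integrable_real_affine) auto
  then show ?thesis
  proof (rule Bochner_Integration.integrable_bound)
    show "AE x in lborel. norm (h x) \<le>
        norm (A / \<beta> * (exponential_density \<beta> x + exponential_density \<beta> (0 + - 1 * x)))"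
    proof (rule AE_I2)
      fix x
      have "\<bar>h x\<bar> \<le> A * exp (- \<beta> * \<bar>x\<bar>)" by (rule A)
      also have "\<dots> \<le> A / \<beta> * (exponential_density \<beta> x + exponential_density \<beta> (0 + - 1 * x))"
        using A(1) assms(2) by (auto simp: exponential_density_def abs_if mult_ac)
      finally show "norm (h x) \<le> norm (A / \<beta> * (exponential_density \<beta> x + exponential_density \<beta> (0 + - 1 * x)))"
        by (simp only: real_norm_def order_trans[OF _ abs_ge_self])
    qed
  qed simp
qed

lemma integrable_exp_smooth_integrand:
  assumes "exp_decay \<beta> h" "\<beta> > 0"
  shows "integrable lborel (\<lambda>t. exponential_density 1 t * h (x - d * t))"
proof -
  note [measurable] = exp_decay_measurable[OF assms(1)]
  obtain A where A: "A \<ge> 0" "\<And>x. \<bar>h x\<bar> \<le> A" using exp_decay_bounded[OF assms] by blast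
  have "integrable lborel (\<lambda>t. exponential_density 1 t * A)"
    using integrable_exponential_density[of 1] by simp
  then show ?thesis
  proof (rule Bochner_Integration.integrable_bound)
    show "AE t in lborel. norm (exponential_density 1 t * h (x - d * t)) \<le> norm (exponential_density 1 t * A)"
      using A by (auto simp: abs_mult intro!: mult_left_mono)
  qed simp
qed

text \<open>A shift by \<open>d * t\<close> costs at most a factor exp (\<beta> |d| t) against the
  weight exp (- t). What remains is an exponential of rate \<open>l\<close>, whose normalization
  gives the constant \<open>A / l\<close>.\<close>

lemma exp_smooth_decay:
  assumes "exp_decay \<beta> h" "\<beta> > 0" "\<beta> * \<bar>d\<bar> < 1"
  shows "exp_decay \<beta> (exp_smooth d h)"
proof -
  note [measurable] = exp_decay_measurable[OF assms(1)]
  obtain A where A: "A \<ge> 0" "\<And>x. \<bar>h x\<bar> \<le> A * exp (- \<beta> * \<bar>x\<bar>)" using exp_decayE[OF assms(1)] by blast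
  define l where "l = 1 - \<beta> * \<bar>d\<bar>"
  have l: "l > 0" using assms by (simp add: l_def)
  have "\<bar>exp_smooth d h x\<bar> \<le> A / l * exp (- \<beta> * \<bar>x\<bar>)" for x
  proof -
    have "\<bar>exp_smooth d h x\<bar> \<le> (LINT t|lborel. A / l * exp (- \<beta> * \<bar>x\<bar>) * exponential_density l t)"
      unfolding exp_smooth_def
    proof (rule integral_abs_bound[THEN order_trans], rule integral_mono)
      show "integrable lborel (\<lambda>t. \<bar>exponential_density 1 t * h (x - d * t)\<bar>)"
        using integrable_exp_smooth_integrand[OF assms(1,2)] by (rule integrable_abs)
      show "integrable lborel (\<lambda>t. A / l * exp (- \<beta> * \<bar>x\<bar>) * exponential_density l t)"
        using integrable_exponential_density(1)[OF l] by (rule integrable_mult_right)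
      fix t :: real
      show "\<bar>exponential_density 1 t * h (x - d * t)\<bar> \<le> A / l * exp (- \<beta> * \<bar>x\<bar>) * exponential_density l t"
      proof (cases "t < 0")
        case False
        have "\<bar>x\<bar> - \<bar>d\<bar> * t \<le> \<bar>x - d * t\<bar>"
          using abs_triangle_ineq2[of x "d * t"] False by (simp add: abs_mult)
        then have "- \<beta> * \<bar>x - d * t\<bar> \<le> - \<beta> * (\<bar>x\<bar> - \<bar>d\<bar> * t)"
          using assms(2) by (simp add: mult_left_mono)
        then have "exp (- \<beta> * \<bar>x - d * t\<bar>) \<le> exp (- \<beta> * (\<bar>x\<bar> - \<bar>d\<bar> * t))" by simp
        then have "\<bar>h (x - d * t)\<bar> \<le> A * exp (- \<beta> * (\<bar>x\<bar> - \<bar>d\<bar> * t))"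
          using A(2)[of "x - d * t"] A(1) by (meson mult_left_mono order_trans)
        then have "exp (- t) * \<bar>h (x - d * t)\<bar> \<le> exp (- t) * (A * exp (- \<beta> * (\<bar>x\<bar> - \<bar>d\<bar> * t)))"
          by (intro mult_left_mono) auto
        also have "\<dots> = A * exp (- \<beta> * \<bar>x\<bar>) * exp (- t * l)"
          by (simp add: l_def algebra_simps flip: exp_add)
        finally show ?thesis using False l by (simp add: exponential_density_def abs_mult)
      qed (simp add: exponential_density_def)
    qed
    also have "\<dots> = A / l * exp (- \<beta> * \<bar>x\<bar>)" using integrable_exponential_density(2)[OF l] by simp
    finally show ?thesis .
  qed
  moreover have "exp_smooth d h \<in> borel_measurable borel" unfolding exp_smooth_def by measurable
  moreover have "A / l \<ge> 0" using A(1) l by simp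
  ultimately show ?thesis unfolding exp_decay_def by blast
qed

text \<open>Substituting s = x - d t turns \<open>exp (x / d) * exp_smooth d h x\<close> into 1 /
  |d| times the integral of \<open>exp (s / d) * h s\<close> over the half line left of
  \<open>x\<close> if \<open>d > 0\<close> and right of \<open>x\<close> if \<open>d < 0\<close>.
  Subtracting the cases \<open>x = b\<close> and \<open>x = a\<close> leaves the integral between
  them, up to \<open>sgn d\<close>.\<close>

lemma exp_primitive_exp_smooth:
  assumes "exp_decay \<beta> h" "\<beta> > 0" "d \<noteq> 0"
  shows "exp_primitive d h (exp_smooth d h)"
proof -
  note [measurable] = exp_decay_measurable[OF assms(1)]
  define f where "f = (\<lambda>x s. if (x - s) / d \<ge> 0 then exp (s / d) * h s else 0)"
  have f_aff: "f x (x + (- d) * t) = exp (x / d) * (exponential_density 1 t * h (x - d * t))" for x t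
  proof -
    have "exp (x / d - t) = exp (x / d) * exp (- t)" by (simp flip: exp_add)
    then show ?thesis using assms(3)
      by (simp add: f_def exponential_density_def diff_divide_distrib algebra_simps)
  qed
  have int_f: "integrable lborel (f x)" for x
  proof -
    have "integrable lborel (\<lambda>t. f x (x + (- d) * t))"
      unfolding f_aff using integrable_exp_smooth_integrand[OF assms(1,2)] by simp
    then show ?thesis using lborel_integrable_real_affine_iff[of "- d" "f x" x] assms(3) by simp
  qed
  have G: "integral\<^sup>L lborel (f x) = \<bar>d\<bar> * (exp (x / d) * exp_smooth d h x)" for x
    
    using lborel_integral_real_affine[of "- d" "f x" x] assms(3) unfolding f_aff exp_smooth_def by simp
  show ?thesis unfolding exp_primitive_def
  proof (intro allI impI)
    fix a b :: real assume "a \<le> b"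
    have "((\<lambda>s. f b s - f a s) has_integral integral\<^sup>L lborel (f b) - integral\<^sup>L lborel (f a)) UNIV"
      by (intro has_integral_diff has_integral_integral_lborel int_f)
    then have "((\<lambda>s. sgn d * (f b s - f a s)) has_integral
        sgn d * (\<bar>d\<bar> * (exp (b / d) * exp_smooth d h b) - \<bar>d\<bar> * (exp (a / d) * exp_smooth d h a))) UNIV"
      unfolding G by (rule has_integral_mult_right)
    also have "sgn d * (\<bar>d\<bar> * (exp (b / d) * exp_smooth d h b) - \<bar>d\<bar> * (exp (a / d) * exp_smooth d h a))
       = d * (exp (b / d) * exp_smooth d h b - exp (a / d) * exp_smooth d h a)"
      by (simp add: algebra_simps sgn_if abs_if)
    finally have "((\<lambda>s. if s \<in> {a..b} then exp (s / d) * h s else 0) has_integral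
        d * (exp (b / d) * exp_smooth d h b - exp (a / d) * exp_smooth d h a)) UNIV"
      by (rule has_integral_spike_finite[of "{a, b}", rotated 2])
         (use \<open>a \<le> b\<close> assms(3) in \<open>auto simp: f_def sgn_if zero_le_divide_iff\<close>)
    then show "((\<lambda>s. exp (s / d) * h s) has_integral
        d * (exp (b / d) * exp_smooth d h b - exp (a / d) * exp_smooth d h a)) {a..b}"
      by (simp only: has_integral_restrict_UNIV)
  qed
qed

section \<open>Fourier transforms of the kernels\<close>

lemma integrable_times_unimodular:
  fixes h :: "real \<Rightarrow> real" and \<phi> :: "real \<Rightarrow> real"
  assumes "integrable lborel h" and [measurable]: "\<phi> \<in> borel_measurable borel"
  shows "integrable lborel (\<lambda>x. complex_of_real (h x) * exp (- (\<i> * complex_of_real (\<phi> x))))"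
proof (rule Bochner_Integration.integrable_bound[OF assms(1)])
  note [measurable] = borel_measurable_integrable[OF assms(1)]
  show "(\<lambda>x. complex_of_real (h x) * exp (- (\<i> * complex_of_real (\<phi> x)))) \<in> borel_measurable lborel"
    by measurable
qed (simp add: norm_mult)

lemma fourier_alt: "fourier h \<xi> = (LINT x|lborel. complex_of_real (h x) * exp (- (\<i> * complex_of_real (2 * pi * \<xi> * x))))"
  unfolding fourier_def by (simp add: mult_ac)

text \<open>The convolution theorem: after Fubini, translation by \<open>d * t\<close> splits off
  the factor \<open>e (d * t)\<close>, which joins the exponential density.\<close>

lemma fourier_exp_smooth:
  assumes "exp_decay \<beta> h" "\<beta> > 0"
  shows "fourier (exp_smooth d h) \<xi> = inverse (1 + \<i> * complex_of_real (2 * pi * d * \<xi>)) * fourier h \<xi>"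
proof -
  note [measurable] = exp_decay_measurable[OF assms(1)]
  define w where "w = 2 * pi * \<xi>"
  define e where "e = (\<lambda>x. exp (- (\<i> * complex_of_real (w * x))))"
  have e_add: "e (x + y) = e x * e y" for x y by (simp add: e_def algebra_simps flip: exp_add)
  have ne: "norm (e x) = 1" for x by (simp add: e_def)
  have [measurable]: "e \<in> borel_measurable borel" unfolding e_def by measurable
  have int_h: "integrable lborel h" using assms by (rule exp_decay_integrable)
  define f where "f = (\<lambda>t x. complex_of_real (exponential_density 1 t) * complex_of_real (h (x - d * t)) * e x)"
  have shift: "integrable lborel (\<lambda>x. h (x - d * t))" "(LINT x|lborel. \<bar>h (x - d * t)\<bar>) = (LINT x|lborel. \<bar>h x\<bar>)" for t
    using lborel_integrable_real_affine[OF int_h, of 1 "- d * t"]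
      lborel_integral_real_affine[of 1 "\<lambda>x. \<bar>h x\<bar>" "- d * t"] by (simp_all add: algebra_simps)
  have "integrable (lborel \<Otimes>\<^sub>M lborel) (case_prod f)"
  proof (rule lborel_pair.Fubini_integrable)
    show "case_prod f \<in> borel_measurable (lborel \<Otimes>\<^sub>M lborel)" unfolding f_def by measurable
    have "(LINT x|lborel. norm (f t x)) = exponential_density 1 t * (LINT x|lborel. \<bar>h x\<bar>)" for t
      using shift(2)[of t] by (simp add: f_def norm_mult ne)
    then show "integrable lborel (\<lambda>t. LINT x|lborel. norm (case_prod f (t, x)))"
      using integrable_exponential_density(1)[of 1] by simp
    have "integrable lborel (f t)" for t
    proof (rule Bochner_Integration.integrable_bound)
      show "integrable lborel (\<lambda>x. exponential_density 1 t * h (x - d * t))" using shift(1) by simp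
    qed (simp_all add: f_def norm_mult ne abs_mult)
    then show "AE t in lborel. integrable lborel (\<lambda>x. case_prod f (t, x))" by simp
  qed
  then have "(LINT x|lborel. LINT t|lborel. f t x) = (LINT t|lborel. LINT x|lborel. f t x)"
    by (rule lborel_pair.Fubini_integral)
  moreover have "(LINT t|lborel. f t x) = complex_of_real (exp_smooth d h x) * e x" for x
  proof -
    have "f t x = complex_of_real (exponential_density 1 t * h (x - d * t)) * e x" for t by (simp add: f_def)
    then show ?thesis unfolding exp_smooth_def
      by (simp only: integral_mult_left_zero integral_complex_of_real)
  qed
  moreover have "(LINT x|lborel. f t x) = complex_of_real (exponential_density 1 t) * e (d * t) * fourier h \<xi>" for t
  proof -
    have "(LINT x|lborel. f t x) = (LINT x|lborel. f t (d * t + 1 * x))"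
      using lborel_integral_real_affine[of 1 "f t" "d * t"] by simp
    also have "\<dots> = (LINT x|lborel. complex_of_real (exponential_density 1 t) * e (d * t) * (complex_of_real (h x) * e x))"
      by (simp add: f_def e_add mult_ac)
    also have "\<dots> = complex_of_real (exponential_density 1 t) * e (d * t) * fourier h \<xi>"
      unfolding fourier_alt e_def w_def by (rule integral_mult_right_zero)
    finally show ?thesis .
  qed
  ultimately have "(LINT x|lborel. complex_of_real (exp_smooth d h x) * e x)
      = (LINT t|lborel. complex_of_real (exponential_density 1 t) * e (d * t)) * fourier h \<xi>"
    by simp
  also have "(LINT t|lborel. complex_of_real (exponential_density 1 t) * e (d * t))
      = inverse (1 + \<i> * complex_of_real (2 * pi * d * \<xi>))"
    using exponential_density_char[of "2 * pi * d * \<xi>"] by (simp add: e_def w_def mult_ac)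
  finally show ?thesis unfolding fourier_alt e_def w_def .
qed

text \<open>The value of the order-one kernel at its jump is chosen to make it right-continuous for both signs of \<open>\<delta> 0\<close>.\<close>

primrec tp_kernel :: "(nat \<Rightarrow> real) \<Rightarrow> nat \<Rightarrow> real \<Rightarrow> real" where
  "tp_kernel \<delta> 0 = (\<lambda>x. if (\<delta> 0 > 0 \<longleftrightarrow> x \<ge> 0) then exp (- x / \<delta> 0) / \<bar>\<delta> 0\<bar> else 0)"
| "tp_kernel \<delta> (Suc i) = exp_smooth (\<delta> (Suc i)) (tp_kernel \<delta> i)"

lemma tp_kernel_decay:
  assumes "\<And>k. k \<le> i \<Longrightarrow> \<delta> k \<noteq> 0"
  obtains \<beta> where "\<beta> > 0" "exp_decay \<beta> (tp_kernel \<delta> i)"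
proof -
  \<comment> \<open>Strictly below every 1 / |\<delta> k|, so one rate survives all smoothing
    steps.\<close>
  define \<beta> where "\<beta> = 1 / (1 + (\<Sum>k\<le>i. \<bar>\<delta> k\<bar>))"
  have s: "0 \<le> (\<Sum>k\<le>i. \<bar>\<delta> k\<bar>)" by (intro sum_nonneg) auto
  then have \<beta>: "\<beta> > 0" unfolding \<beta>_def by (intro divide_pos_pos add_pos_nonneg) auto
  have b: "\<beta> * \<bar>\<delta> k\<bar> < 1" if "k \<le> i" for k
  proof -
    have "\<bar>\<delta> k\<bar> \<le> (\<Sum>k\<le>i. \<bar>\<delta> k\<bar>)" using that by (intro member_le_sum) auto
    then show ?thesis using s by (simp add: \<beta>_def)
  qed
  have "exp_decay \<beta> (tp_kernel \<delta> k)" if "k \<le> i" for k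
    using that
  proof (induction k)
    case 0
    have "\<bar>tp_kernel \<delta> 0 x\<bar> \<le> 1 / \<bar>\<delta> 0\<bar> * exp (- \<beta> * \<bar>x\<bar>)" for x
    proof (cases "\<delta> 0 > 0 \<longleftrightarrow> x \<ge> 0")
      case True
      then have "x / \<delta> 0 = \<bar>x\<bar> / \<bar>\<delta> 0\<bar>" using assms[of 0] by (auto simp: abs_if)
      also have "\<dots> = \<bar>x\<bar> * (1 / \<bar>\<delta> 0\<bar>)" by simp
      also have "\<dots> \<ge> \<bar>x\<bar> * \<beta>" using b[of 0] assms[of 0] by (intro mult_left_mono) (auto simp: field_simps)
      finally have "- x / \<delta> 0 \<le> - \<beta> * \<bar>x\<bar>" by (simp add: mult_ac)
      then show ?thesis using True assms[of 0] by (simp add: divide_right_mono)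
    qed auto
    moreover have "1 / \<bar>\<delta> 0\<bar> \<ge> 0" by simp
    moreover have "tp_kernel \<delta> 0 \<in> borel_measurable borel" by simp
    ultimately show ?case unfolding exp_decay_def by blast
  next
    case (Suc k)
    then show ?case using exp_smooth_decay[OF _ \<beta> b[of "Suc k"]] by simp
  qed
  then show ?thesis using that \<beta> by blast
qed

lemma tp_kernel_primitive:
  assumes "\<And>k. k \<le> Suc i \<Longrightarrow> \<delta> k \<noteq> 0"
  shows "exp_primitive (\<delta> (Suc i)) (tp_kernel \<delta> i) (tp_kernel \<delta> (Suc i))"
proof -
  obtain \<beta> where "\<beta> > 0" "exp_decay \<beta> (tp_kernel \<delta> i)"
    using tp_kernel_decay[of i \<delta>] assms by auto
  then show ?thesis using exp_primitive_exp_smooth assms[of "Suc i"] by simp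
qed

lemma fourier_tp_kernel_0:
  assumes "\<delta> 0 \<noteq> 0"
  shows "fourier (tp_kernel \<delta> 0) \<xi> = inverse (1 + \<i> * complex_of_real (2 * pi * \<delta> 0 * \<xi>))"
proof -
  have [measurable]: "tp_kernel \<delta> 0 \<in> borel_measurable borel" by simp
  let ?f = "\<lambda>x. complex_of_real (tp_kernel \<delta> 0 x) * exp (- (\<i> * complex_of_real (2 * pi * \<xi> * x)))"
  have "fourier (tp_kernel \<delta> 0) \<xi> = \<bar>\<delta> 0\<bar> *\<^sub>R (LINT t|lborel. ?f (0 + \<delta> 0 * t))"
    unfolding fourier_alt using assms by (rule lborel_integral_real_affine)
  also have "\<dots> = (LINT t|lborel. \<bar>\<delta> 0\<bar> *\<^sub>R ?f (0 + \<delta> 0 * t))" by simp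
  also have "\<dots> = (LINT t|lborel. complex_of_real (exponential_density 1 t) *
      exp (- (\<i> * complex_of_real ((2 * pi * \<delta> 0 * \<xi>) * t))))"
  proof (rule integral_cong_AE)
    have "\<bar>\<delta> 0\<bar> *\<^sub>R ?f (0 + \<delta> 0 * t) = complex_of_real (exponential_density 1 t) *
      exp (- (\<i> * complex_of_real ((2 * pi * \<delta> 0 * \<xi>) * t)))" if "t \<noteq> 0" for t
      using that assms
      by (cases "\<delta> 0 > 0") (auto simp: exponential_density_def zero_le_mult_iff scaleR_conv_of_real mult_ac)
    then show "AE t in lborel. \<bar>\<delta> 0\<bar> *\<^sub>R ?f (0 + \<delta> 0 * t) = complex_of_real (exponential_density 1 t) *
      exp (- (\<i> * complex_of_real ((2 * pi * \<delta> 0 * \<xi>) * t)))"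
      by (rule AE_mp[OF AE_lborel_singleton[of 0] AE_I2, OF impI])
  qed measurable
  finally show ?thesis by (simp only: exponential_density_char)
qed

lemma fourier_tp_kernel:
  assumes "\<And>k. k \<le> i \<Longrightarrow> \<delta> k \<noteq> 0"
  shows "fourier (tp_kernel \<delta> i) \<xi> = (\<Prod>k\<le>i. inverse (1 + \<i> * complex_of_real (2 * pi * \<delta> k * \<xi>)))"
  using assms
proof (induction i)
  case 0 then show ?case using fourier_tp_kernel_0 by simp
next
  case (Suc i)
  obtain \<beta> where "\<beta> > 0" "exp_decay \<beta> (tp_kernel \<delta> i)"
    using tp_kernel_decay[of i \<delta>] Suc.prems by auto
  then show ?case using fourier_exp_smooth[of \<beta> "tp_kernel \<delta> i" "\<delta> (Suc i)" \<xi>] Suc by (simp add: mult_ac)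
qed

section \<open>Uniqueness of the Fourier transform\<close>

lemma fourier_nonneg_unique:
  fixes F G :: "real \<Rightarrow> real"
  assumes F: "integrable lborel F" "\<And>x. 0 \<le> F x" and G: "integrable lborel G" "\<And>x. 0 \<le> G x"
    and pos: "0 < integral\<^sup>L lborel F" and eq: "\<And>\<xi>. fourier F \<xi> = fourier G \<xi>"
  shows "AE x in lborel. F x = G x"
proof -
  define c where "c = integral\<^sup>L lborel F"
  have "complex_of_real (integral\<^sup>L lborel F) = complex_of_real (integral\<^sup>L lborel G)"
    using eq[of 0] by (simp add: fourier_def)
  then have cG: "integral\<^sup>L lborel G = c" by (simp add: c_def)
  have c: "c > 0" using pos by (simp add: c_def)
  \<comment> \<open>Dividing by the common mass \<open>c\<close> yields probability densities; their
    characteristic functions are Fourier transforms at \<open>- t / (2 * pi)\<close>, up to the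
    factor \<open>1 / c\<close>.\<close>
  have dist: "real_distribution (density lborel (\<lambda>x. ennreal (H x / c)))"
    and char: "char (density lborel (\<lambda>x. ennreal (H x / c))) t = fourier H (- t / (2 * pi)) / complex_of_real c"
    if H: "integrable lborel H" "\<And>x. 0 \<le> H x" "integral\<^sup>L lborel H = c" for H t
  proof -
    note [measurable] = borel_measurable_integrable[OF H(1)]
    have "(\<integral>\<^sup>+x. ennreal (H x / c) \<partial>lborel) = ennreal (\<integral>x. H x / c \<partial>lborel)"
      using H c by (intro nn_integral_eq_integral) auto
    also have "\<dots> = 1" using H c by simp
    finally have "prob_space (density lborel (\<lambda>x. ennreal (H x / c)))"
      by (intro prob_spaceI) (simp add: emeasure_density)
    then show "real_distribution (density lborel (\<lambda>x. ennreal (H x / c)))"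
      by (simp add: real_distribution_def real_distribution_axioms_def)
    have "char (density lborel (\<lambda>x. ennreal (H x / c))) t = (LINT x|lborel. (H x / c) *\<^sub>R iexp (t * x))"
      unfolding char_def using H(2) c by (intro integral_density) auto
    also have "\<dots> = (LINT x|lborel. complex_of_real (H x) * iexp (t * x) / complex_of_real c)"
      by (simp add: scaleR_conv_of_real)
    also have "\<dots> = fourier H (- t / (2 * pi)) / complex_of_real c"
      unfolding fourier_alt by simp
    finally show "char (density lborel (\<lambda>x. ennreal (H x / c))) t = fourier H (- t / (2 * pi)) / complex_of_real c" .
  qed
  have "density lborel (\<lambda>x. ennreal (F x / c)) = density lborel (\<lambda>x. ennreal (G x / c))"
    using F G cG eq char[OF F c_def[symmetric]] char[OF G cG]
    by (intro Levy_uniqueness dist ext) (simp_all add: c_def)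
  then have "AE x in lborel. ennreal (F x / c) = ennreal (G x / c)"
    using F G by (intro sigma_finite_measure.density_unique[OF lborel.sigma_finite_measure_axioms]) auto
  then show ?thesis using F(2) G(2) c by (auto simp: divide_right_mono)
qed

lemma fourier_add:
  assumes "integrable lborel f" "integrable lborel g"
  shows "fourier (\<lambda>x. f x + g x) \<xi> = fourier f \<xi> + fourier g \<xi>"
proof -
  let ?e = "\<lambda>x. exp (- (\<i> * complex_of_real (2 * pi * \<xi> * x)))"
  have "fourier f \<xi> + fourier g \<xi> = (LINT x|lborel. complex_of_real (f x) * ?e x + complex_of_real (g x) * ?e x)"
    unfolding fourier_alt
    by (rule Bochner_Integration.integral_add[symmetric]; rule integrable_times_unimodular) (simp_all add: assms)
  then show ?thesis unfolding fourier_alt by (simp only: of_real_add distrib_right)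
qed

text \<open>Adding a common function to both sides reduces to positive densities, where Levy's theorem applies.\<close>

lemma fourier_unique:
  fixes f g :: "real \<Rightarrow> real"
  assumes f: "integrable lborel f" and g: "integrable lborel g" and eq: "\<And>\<xi>. fourier f \<xi> = fourier g \<xi>"
  shows "AE x in lborel. f x = g x"
proof -
  \<comment> \<open>The absolute values make both sums nonnegative; the exponential density keeps
    their mass positive even when \<open>f\<close> and \<open>g\<close> vanish.\<close>
  define P where "P = (\<lambda>x. \<bar>f x\<bar> + \<bar>g x\<bar> + exponential_density 1 x)"
  note ed = integrable_exponential_density[of 1, simplified]
  have P: "integrable lborel P" using f g ed unfolding P_def
    by (intro Bochner_Integration.integrable_add integrable_abs)
  have nn: "0 \<le> f x + P x" "0 \<le> g x + P x" "exponential_density 1 x \<le> f x + P x" for x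
    using exponential_density_nonneg[of 1 x, OF zero_less_one] unfolding P_def by linarith+
  have "(\<integral>x. exponential_density 1 x \<partial>lborel) \<le> (\<integral>x. f x + P x \<partial>lborel)"
    using ed f P nn by (intro integral_mono) auto
  then have "AE x in lborel. f x + P x = g x + P x"
    using f g P nn ed eq by (intro fourier_nonneg_unique) (auto simp: fourier_add)
  then show ?thesis by simp
qed

lemma AE_lborel_continuous_eq:
  fixes f g :: "real \<Rightarrow> real"
  assumes "continuous_on UNIV f" "continuous_on UNIV g" "AE x in lborel. f x = g x"
  shows "f = g"
proof -
  have op: "open {x. f x \<noteq> g x}" by (intro open_Collect_neq assms)
  then have "{x. f x \<noteq> g x} \<in> null_sets lborel"
    using assms(3) by (intro AE_iff_null_sets[THEN iffD2]) auto
  then have "negligible {x. f x \<noteq> g x}"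
    by (simp add: negligible_iff_null_sets null_sets_completionI)
  then have "{x. f x \<noteq> g x} = {}" using op open_not_negligible by blast
  then show ?thesis by auto
qed

text \<open>Equal Fourier transforms give equality almost everywhere only, and the integers are a
  null set; continuity of both sides makes the formula valid at the sampling points. With
  \<open>m = i + 2\<close> the kernel of index \<open>Suc i\<close> has exactly \<open>m\<close>
  factors.\<close>

lemma totally_positive_kernel:
  assumes tp: "totally_positive_finite_type g m" and m: "m \<ge> 2" and cont: "continuous_on UNIV g"
  obtains C \<delta> i where "C > 0" "\<And>k. \<delta> k \<noteq> 0" "g = (\<lambda>x. C * tp_kernel \<delta> (Suc i) x)"
proof -
  obtain C d where C: "C > 0" and d: "\<forall>k<m. d k \<noteq> 0" and int: "integrable lborel g" and
    four: "\<And>\<xi>. fourier g \<xi> =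
      complex_of_real C * (\<Prod>k<m. inverse (1 + 2 * complex_of_real pi * \<i> * complex_of_real (d k * \<xi>)))"
    using tp unfolding totally_positive_finite_type_def by blast
  obtain i where i: "m = Suc (Suc i)" using m by (metis Suc_le_D numeral_2_eq_2 Suc_le_mono)
  \<comment> \<open>Padding with 1 makes every entry nonzero, so later statements carry no index
    bound.\<close>
  define \<delta> where "\<delta> = (\<lambda>k. if k < m then d k else 1)"
  have \<delta>: "\<delta> k \<noteq> 0" for k using d by (simp add: \<delta>_def)
  obtain \<beta> where \<beta>: "\<beta> > 0" "exp_decay \<beta> (tp_kernel \<delta> (Suc i))"
    using tp_kernel_decay[of "Suc i" \<delta>] \<delta> by blast
  have intk: "integrable lborel (tp_kernel \<delta> (Suc i))" using exp_decay_integrable[OF \<beta>(2,1)] .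
  have fk: "fourier (\<lambda>x. C * tp_kernel \<delta> (Suc i) x) \<xi> = fourier g \<xi>" for \<xi>
  proof -
    have "fourier (\<lambda>x. C * tp_kernel \<delta> (Suc i) x) \<xi> = complex_of_real C * fourier (tp_kernel \<delta> (Suc i)) \<xi>"
      unfolding fourier_alt by (simp only: of_real_mult mult.assoc integral_mult_right_zero)
    also have "fourier (tp_kernel \<delta> (Suc i)) \<xi> =
        (\<Prod>k<m. inverse (1 + 2 * complex_of_real pi * \<i> * complex_of_real (d k * \<xi>)))"
      unfolding fourier_tp_kernel[OF \<delta>] i lessThan_Suc_atMost
      by (intro prod.cong) (auto simp: \<delta>_def i mult_ac)
    finally show ?thesis using four by simp
  qed
  have "AE x in lborel. C * tp_kernel \<delta> (Suc i) x = g x"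
    using intk int fk by (intro fourier_unique) auto
  moreover have "continuous_on UNIV (\<lambda>x. C * tp_kernel \<delta> (Suc i) x)"
    using exp_primitive_continuous[OF tp_kernel_primitive[OF \<delta>] \<delta>] by (intro continuous_intros)
  ultimately have "(\<lambda>x. C * tp_kernel \<delta> (Suc i) x) = g" using AE_lborel_continuous_eq cont by blast
  then show ?thesis using that[of C \<delta> i] C \<delta> by simp
qed

lemma fourier_reflect: "fourier (\<lambda>x. g (- x)) \<xi> = fourier g (- \<xi>)"
  unfolding fourier_alt
  using lborel_integral_real_affine[of "-1" "\<lambda>x. complex_of_real (g x) * exp (- (\<i> * complex_of_real (2 * pi * (- \<xi>) * x)))" 0]
  by simp

text \<open>Reflection replaces \<xi> by - \<xi>, that is each \<delta> by - \<delta>, and the class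
  admits either sign.\<close>

lemma totally_positive_reflect:
  assumes "totally_positive_finite_type g m"
  shows "totally_positive_finite_type (\<lambda>x. g (- x)) m"
proof -
  obtain C d where C: "C > 0" and d: "\<forall>k<m. d k \<noteq> (0::real)" and int: "integrable lborel g" and
    four: "\<And>\<xi>. fourier g \<xi> =
      complex_of_real C * (\<Prod>k<m. inverse (1 + 2 * complex_of_real pi * \<i> * complex_of_real (d k * \<xi>)))"
    using assms unfolding totally_positive_finite_type_def by blast
  have "integrable lborel (\<lambda>x. g (- x))"
    using lborel_integrable_real_affine[OF int, of "-1" 0] by simp
  moreover have "fourier (\<lambda>x. g (- x)) \<xi> = complex_of_real C *
      (\<Prod>k<m. inverse (1 + 2 * complex_of_real pi * \<i> * complex_of_real (- d k * \<xi>)))" for \<xi>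
    unfolding fourier_reflect four by simp
  ultimately show ?thesis using C d unfolding totally_positive_finite_type_def
    by (intro conjI exI[of _ C] exI[of _ "\<lambda>k. - d k"]) auto
qed

text \<open>A Fredholm alternative for finitely many vectors whose index \<open>j\<close> may range
  over an infinite set; the separating functionals are finite combinations of coordinates. The
  induction is Gaussian elimination.\<close>

lemma span_or_separated:
  fixes v :: "'k \<Rightarrow> 'j \<Rightarrow> real" and t :: "'j \<Rightarrow> real"
  assumes "finite S"
  shows "(\<exists>c. \<forall>j. t j = (\<Sum>k\<in>S. c k * v k j)) \<or>
    (\<exists>Y y. finite Y \<and> (\<forall>k\<in>S. (\<Sum>j\<in>Y. y j * v k j) = 0) \<and> (\<Sum>j\<in>Y. y j * t j) \<noteq> 0)"
  using assms
proof (induction S arbitrary: t)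
  case empty
  show ?case
  proof (cases "\<forall>j. t j = 0")
    case False
    then obtain j where "t j \<noteq> 0" by blast
    then show ?thesis by (intro disjI2 exI[of _ "{j}"] exI[of _ "\<lambda>_. 1"]) auto
  qed simp
next
  case (insert x S)
  have extend: "\<exists>c. \<forall>j. t j = (\<Sum>k\<in>insert x S. c k * v k j)" if "\<forall>j. t j - a * v x j = (\<Sum>k\<in>S. c k * v k j)" for t a c
  proof (intro exI allI)
    fix j
    have "(\<Sum>k\<in>S. (if k = x then a else c k) * v k j) = (\<Sum>k\<in>S. c k * v k j)"
      using insert.hyps by (intro sum.cong) auto
    then show "t j = (\<Sum>k\<in>insert x S. (if k = x then a else c k) * v k j)"
      using insert.hyps that[rule_format, of j] by (simp add: algebra_simps)
  qed
  show ?case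
  proof (cases "\<exists>Y y. finite Y \<and> (\<forall>k\<in>S. (\<Sum>j\<in>Y. y j * v k j) = 0) \<and> (\<Sum>j\<in>Y. y j * v x j) \<noteq> 0")
    \<comment> \<open>Every functional annihilating the vectors of \<open>S\<close> also annihilates
      \<open>v x\<close>, so separation from \<open>S\<close> is already separation from
      \<open>insert x S\<close>.\<close>
    case False
    from insert.IH[of t] show ?thesis
    proof
      assume "\<exists>c. \<forall>j. t j = (\<Sum>k\<in>S. c k * v k j)"
      then show ?thesis using extend[of t 0] by auto
    next
      assume "\<exists>Y y. finite Y \<and> (\<forall>k\<in>S. (\<Sum>j\<in>Y. y j * v k j) = 0) \<and> (\<Sum>j\<in>Y. y j * t j) \<noteq> 0"
      then show ?thesis using False by (intro disjI2) (metis insert_iff)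
    qed
  next
    case True
    then obtain Y0 y0 where Y0: "finite Y0" "\<And>k. k \<in> S \<Longrightarrow> (\<Sum>j\<in>Y0. y0 j * v k j) = 0"
      "(\<Sum>j\<in>Y0. y0 j * v x j) \<noteq> 0" by blast
    \<comment> \<open>\<open>L0\<close> is the pivot. The scalar \<open>a\<close> makes
      \<open>L0\<close> vanish on \<open>t - a v x\<close>; the later \<open>b\<close> makes
      \<open>L - b L0\<close> vanish on \<open>v x\<close>, while its value on \<open>t\<close> is
      that of \<open>L\<close> on \<open>t - a v x\<close>.\<close>
    define L0 where "L0 = (\<lambda>w. \<Sum>j\<in>Y0. y0 j * w j)"
    define a where "a = L0 t / L0 (v x)"
    from insert.IH[of "\<lambda>j. t j - a * v x j"] show ?thesis
    proof
      assume "\<exists>c. \<forall>j. t j - a * v x j = (\<Sum>k\<in>S. c k * v k j)"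
      then show ?thesis using extend by blast
    next
      assume "\<exists>Y y. finite Y \<and> (\<forall>k\<in>S. (\<Sum>j\<in>Y. y j * v k j) = 0) \<and> (\<Sum>j\<in>Y. y j * (t j - a * v x j)) \<noteq> 0"
      then obtain Y y where Y: "finite Y" "\<And>k. k \<in> S \<Longrightarrow> (\<Sum>j\<in>Y. y j * v k j) = 0"
        "(\<Sum>j\<in>Y. y j * (t j - a * v x j)) \<noteq> 0" by blast
      define L where "L = (\<lambda>w. \<Sum>j\<in>Y. y j * w j)"
      define b where "b = L (v x) / L0 (v x)"
      define z where "z = (\<lambda>j. (if j \<in> Y then y j else 0) - b * (if j \<in> Y0 then y0 j else 0))"
      have Lz: "(\<Sum>j\<in>Y \<union> Y0. z j * w j) = L w - b * L0 w" for w
      proof -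
        have 1: "(\<Sum>j\<in>Y \<union> Y0. (if j \<in> Y then y j else 0) * w j) = L w"
          unfolding L_def using Y(1) Y0(1) by (intro sum.mono_neutral_cong_right) auto
        have 2: "(\<Sum>j\<in>Y \<union> Y0. (if j \<in> Y0 then y0 j else 0) * w j) = L0 w"
          unfolding L0_def using Y(1) Y0(1) by (intro sum.mono_neutral_cong_right) auto
        have "(\<Sum>j\<in>Y \<union> Y0. z j * w j) = (\<Sum>j\<in>Y \<union> Y0. (if j \<in> Y then y j else 0) * w j)
            - b * (\<Sum>j\<in>Y \<union> Y0. (if j \<in> Y0 then y0 j else 0) * w j)"
          unfolding sum_distrib_left sum_subtractf[symmetric] z_def
          by (intro sum.cong) (simp_all add: left_diff_distrib mult.assoc)
        then show ?thesis unfolding 1 2 .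
      qed
      have "L0 (v x) \<noteq> 0" using Y0(3) by (simp add: L0_def)
      moreover have "L t - a * L (v x) \<noteq> 0"
        using Y(3) by (simp add: L_def right_diff_distrib sum_subtractf sum_distrib_left mult.left_commute)
      ultimately have "L (v x) - b * L0 (v x) = 0" "L t - b * L0 t \<noteq> 0"
        by (auto simp: b_def a_def)
      moreover have "L (v k) - b * L0 (v k) = 0" if "k \<in> S" for k
        using Y(2) Y0(2) that by (simp add: L_def L0_def)
      ultimately show ?thesis using Y(1) Y0(1)
        by (intro disjI2 exI[of _ "Y \<union> Y0"] exI[of _ z]) (auto simp: Lz)
    qed
  qed
qed

section \<open>Splines from translates of the kernel\<close>

lemma tp_kernel_0_same_piece:
  assumes "x \<ge> 0 \<longleftrightarrow> y \<ge> 0"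
  shows "tp_kernel \<delta> 0 y = exp ((x - y) / \<delta> 0) * tp_kernel \<delta> 0 x"
proof -
  have "exp (- y / \<delta> 0) = exp ((x - y) / \<delta> 0) * exp (- x / \<delta> 0)"
    by (simp add: diff_divide_distrib flip: exp_add)
  then show ?thesis using assms by simp
qed

lemma exp_primitive_sum:
  assumes "finite J" "\<And>j. j \<in> J \<Longrightarrow> exp_primitive d (v j) (u j)"
  shows "exp_primitive d (\<lambda>x. \<Sum>j\<in>J. y j * v j x) (\<lambda>x. \<Sum>j\<in>J. y j * u j x)"
  unfolding exp_primitive_def
proof (intro allI impI)
  fix a b :: real assume "a \<le> b"
  then have "((\<lambda>s. \<Sum>j\<in>J. y j * (exp (s / d) * v j s)) has_integral
      (\<Sum>j\<in>J. y j * (d * (exp (b / d) * u j b - exp (a / d) * u j a)))) {a..b}"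
    using assms unfolding exp_primitive_def
    by (intro has_integral_sum has_integral_mult_right) auto
  then show "((\<lambda>s. exp (s / d) * (\<Sum>j\<in>J. y j * v j s)) has_integral
      d * (exp (b / d) * (\<Sum>j\<in>J. y j * u j b) - exp (a / d) * (\<Sum>j\<in>J. y j * u j a))) {a..b}"
    by (simp add: sum_distrib_left sum_subtractf right_diff_distrib mult_ac)
qed

lemma exp_primitive_shift:
  assumes "exp_primitive d v u"
  shows "exp_primitive d (\<lambda>x. v (x + r)) (\<lambda>x. u (x + r))"
  unfolding exp_primitive_def
proof (intro allI impI)
  fix a b :: real assume "a \<le> b"
  then have "((\<lambda>s. exp (s / d) * v s) has_integral
      d * (exp ((b + r) / d) * u (b + r) - exp ((a + r) / d) * u (a + r))) {a + r..b + r}"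
    using assms unfolding exp_primitive_def by auto
  then have "((\<lambda>s. exp ((s + r) / d) * v (s + r)) has_integral
      d * (exp ((b + r) / d) * u (b + r) - exp ((a + r) / d) * u (a + r))) {a..b}"
    using has_integral_shift_real_ivl[of "\<lambda>s. exp (s / d) * v s" _ "a + r" "b + r" r] by simp
  then have "((\<lambda>s. exp (- r / d) * (exp ((s + r) / d) * v (s + r))) has_integral
      exp (- r / d) * (d * (exp ((b + r) / d) * u (b + r) - exp ((a + r) / d) * u (a + r)))) {a..b}"
    by (rule has_integral_mult_right)
  moreover have e: "exp (- r / d) * (exp ((x + r) / d) * z) = exp (x / d) * z" for x z
    by (simp add: mult.assoc[symmetric] add_divide_distrib flip: exp_add)
  moreover have "exp (- r / d) * (d * (exp ((b + r) / d) * u (b + r) - exp ((a + r) / d) * u (a + r)))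
      = d * (exp (b / d) * u (b + r) - exp (a / d) * u (a + r))"
    by (simp only: mult.left_commute[of "exp (- r / d)" d] right_diff_distrib[of "exp (- r / d)"] e)
  ultimately show "((\<lambda>s. exp (s / d) * v (s + r)) has_integral
      d * (exp (b / d) * u (b + r) - exp (a / d) * u (a + r))) {a..b}"
    by (simp only:)
qed

text \<open>The translate with index \<open>j\<close> jumps where x + n + q j = 0, so the knots are
  - n + q \<int>, which explains the base point \<open>- n\<close>.\<close>

lemma exp_spline_tp_kernel:
  assumes \<delta>: "\<And>k. \<delta> k \<noteq> 0" and q: "q > 0" and J: "finite J"
  shows "exp_spline \<delta> (\<lambda>i x. \<Sum>j\<in>J. y j * tp_kernel \<delta> i (x + (n + q * of_int j))) (- n) q"
proof
  show "exp_primitive (\<delta> (Suc i)) (\<lambda>x. \<Sum>j\<in>J. y j * tp_kernel \<delta> i (x + (n + q * of_int j)))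
     (\<lambda>x. \<Sum>j\<in>J. y j * tp_kernel \<delta> (Suc i) (x + (n + q * of_int j)))" for i
    by (intro exp_primitive_sum[OF J] exp_primitive_shift tp_kernel_primitive \<delta>)
  fix x z :: real assume eq: "\<lfloor>(x - - n) / q\<rfloor> = \<lfloor>(z - - n) / q\<rfloor>"
  have nonneg_iff: "x + (n + q * of_int j) \<ge> 0 \<longleftrightarrow> - j \<le> \<lfloor>(x - - n) / q\<rfloor>" for x j
  proof -
    have "- j \<le> \<lfloor>(x - - n) / q\<rfloor> \<longleftrightarrow> of_int (- j) \<le> (x - - n) / q" by (rule le_floor_iff)
    also have "\<dots> \<longleftrightarrow> of_int (- j) * q \<le> x + n" using q by (simp add: pos_le_divide_eq)
    finally show ?thesis by (auto simp: algebra_simps)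
  qed
  have "tp_kernel \<delta> 0 (z + (n + q * of_int j)) = exp ((x - z) / \<delta> 0) * tp_kernel \<delta> 0 (x + (n + q * of_int j))" for j
    using tp_kernel_0_same_piece[of "x + (n + q * of_int j)" "z + (n + q * of_int j)" \<delta>]
    unfolding nonneg_iff eq by simp
  then show "(\<Sum>j\<in>J. y j * tp_kernel \<delta> 0 (z + (n + q * of_int j))) =
      exp ((x - z) / \<delta> 0) * (\<Sum>j\<in>J. y j * tp_kernel \<delta> 0 (x + (n + q * of_int j)))"
    by (simp only: sum_distrib_left mult.left_commute)
qed (use \<delta> q in auto)

text \<open>Subtracting the value transported from distance \<open>p\<close> on the left gives 0
  within one piece and otherwise the jump crossed. The kernel jumps at 0, and since
  \<open>p < q\<close> only \<open>j = 0\<close> puts 0 into (q j - p, q j].\<close>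

lemma tp_kernel_0_jump:
  assumes "\<delta> 0 \<noteq> 0" "0 < p" "p < q"
  shows "tp_kernel \<delta> 0 (q * of_int j) - exp (- p / \<delta> 0) * tp_kernel \<delta> 0 (q * of_int j - p)
    = (if j = 0 then 1 / \<delta> 0 else 0)"
proof -
  consider "j = 0" | "j \<ge> 1" | "j \<le> -1" by linarith
  then show ?thesis
  proof cases
    case 1
    then show ?thesis using assms by (auto simp: abs_if simp flip: exp_add)
  next
    case 2
    then have "q * 1 \<le> q * of_int j" using assms by (intro mult_left_mono) auto
    then have "p \<le> q * of_int j" using assms by linarith
    then show ?thesis using tp_kernel_0_same_piece[of "q * of_int j - p" "q * of_int j" \<delta>] 2 assms by auto
  next
    case 3
    then have "q * of_int j \<le> q * (-1)" using assms by (intro mult_left_mono) auto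
    then show ?thesis using tp_kernel_0_same_piece[of "q * of_int j - p" "q * of_int j" \<delta>] 3 assms by auto
  qed
qed

text \<open>By duality a solution exists unless some finite combination \<open>y\<close> of the conditions, with \<open>y 0 \<noteq> 0\<close>,
  annihilates all the kernels in a long window. Such a \<open>y\<close> gives a spline with knots of spacing \<open>q\<close> that vanishes
  at many consecutive points of spacing \<open>p < q\<close>, hence vanishes around the knot \<open>- n\<close>, whose jump is \<open>y 0 / \<delta> 0\<close>.\<close>

theorem tp_kernel_dual_coefficients:
  assumes \<delta>: "\<And>k. \<delta> k \<noteq> 0" and p: "0 < p" "p < q"
  shows "\<exists>c S. finite S \<and> (\<forall>j::int. (\<Sum>k\<in>S. c k * tp_kernel \<delta> (Suc i) (n + q * of_int j - p * of_int (k::int)))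
    = (if j = 0 then 1 else 0))"
proof -
  \<comment> \<open>The knot \<open>- n\<close> lies in [L p, (L + 1) p), so the two gaps from (L -
    1) p to (L + 1) p contain both \<open>- n\<close> and \<open>- n - p\<close>.\<close>
  define L where "L = \<lfloor>- n / p\<rfloor>"
  have "of_int L \<le> - n / p" "- n / p < of_int L + 1" unfolding L_def by linarith+
  then have L: "of_int L * p \<le> - n" "- n < (of_int L + 1) * p"
    using p by (simp_all only: pos_le_divide_eq pos_divide_less_eq)
  obtain N :: nat where "real (i + 2) * q / (q - p) \<le> real N" using real_arch_simple by blast
  then have N: "real (i + 2) * q \<le> real N * (q - p)" using p by (simp add: pos_divide_le_eq)
  \<comment> \<open>One index for each of the \<open>N + 3\<close> points (L - 1 - N) p, ..., (L +
    1) p: \<open>N\<close> gaps in which to find an interval of zeros, then the two gaps around the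
    knot. The order is reversed because \<open>k\<close> enters with a minus sign.\<close>
  define S where "S = {- 1 - L .. int N + 1 - L}"
  define v where "v = (\<lambda>k j. tp_kernel \<delta> (Suc i) (n + q * of_int j - p * of_int (k::int)))"
  define t where "t = (\<lambda>j::int. if j = 0 then 1 else 0 :: real)"
  have "\<not> (\<exists>Y y. finite Y \<and> (\<forall>k\<in>S. (\<Sum>j\<in>Y. y j * v k j) = 0) \<and> (\<Sum>j\<in>Y. y j * t j) \<noteq> 0)"
  proof
    assume "\<exists>Y y. finite Y \<and> (\<forall>k\<in>S. (\<Sum>j\<in>Y. y j * v k j) = 0) \<and> (\<Sum>j\<in>Y. y j * t j) \<noteq> 0"
    then obtain Y y where Y: "finite Y" "\<And>k. k \<in> S \<Longrightarrow> (\<Sum>j\<in>Y. y j * v k j) = 0"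
      "(\<Sum>j\<in>Y. y j * t j) \<noteq> 0" by blast
    define u where "u = (\<lambda>i x. \<Sum>j\<in>Y. y j * tp_kernel \<delta> i (x + (n + q * of_int j)))"
    have q: "q > 0" using p by simp
    interpret exp_spline \<delta> u "- n" q
      unfolding u_def by (rule exp_spline_tp_kernel[OF \<delta> q Y(1)])
    define A where "A = (of_int L - 1 - real N) * p"
    have zeros: "u (Suc i) (A + real k * p) = 0" if "k \<le> N + 2" for k
    proof -
      define k' where "k' = int N + 1 - L - int k"
      have "k' \<in> S" using that by (auto simp: S_def k'_def)
      moreover have "A + real k * p + (n + q * of_int j) = n + q * of_int j - p * of_int k'" for j
        by (simp add: A_def k'_def algebra_simps)
      ultimately show ?thesis using Y(2)[of k'] by (simp add: u_def v_def)
    qed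
    have "A + real N * p = of_int L * p - p" "A + real (N + 2) * p = of_int L * p + p"
      by (simp_all add: A_def algebra_simps)
    then have z: "u 0 s = 0" if "of_int L * p - p \<le> s" "s < of_int L * p + p" for s
      using zeros_force_vanishing[of p N 2 i A s] p zeros N that by simp
    have "u 0 (- n) = 0" "u 0 (- n - p) = 0" using L p by (auto intro!: z simp: algebra_simps)
    \<comment> \<open>This combination of two values removes every translate except the one with
      \<open>j = 0\<close>.\<close>
    then have "0 = u 0 (- n) - exp (- p / \<delta> 0) * u 0 (- n - p)" by simp
    also have "\<dots> = (\<Sum>j\<in>Y. y j * (tp_kernel \<delta> 0 (q * of_int j) - exp (- p / \<delta> 0) * tp_kernel \<delta> 0 (q * of_int j - p)))"
      unfolding u_def sum_distrib_left sum_subtractf[symmetric]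
      by (intro sum.cong) (simp_all add: algebra_simps del: tp_kernel.simps)
    also have "\<dots> = (\<Sum>j\<in>Y. y j * t j) / \<delta> 0"
      unfolding tp_kernel_0_jump[of \<delta> p q, OF \<delta> p] sum_divide_distrib t_def by (intro sum.cong) auto
    finally show False using Y(3) \<delta>[of 0] by simp
  qed
  then obtain c where "\<forall>j. t j = (\<Sum>k\<in>S. c k * v k j)"
    using span_or_separated[of S t v] by (auto simp: S_def)
  then show ?thesis unfolding v_def t_def by (intro exI[of _ c] exI[of _ S]) (auto simp: S_def)
qed

section \<open>Gabor systems on the integers\<close>

no_notation Infinite_Set_Sum.abs_summable_on (infix \<open>abs'_summable'_on\<close> 50)

text \<open>Cauchy-Schwarz with \<open>A x y\<close> split into two square roots, then exchange of
  summation. Everything is done for finite sums and passed to the limit, so summability comes out as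
  a conclusion.\<close>

lemma schur_test:
  fixes A :: "'x \<Rightarrow> 'y \<Rightarrow> real"
  assumes nonneg: "\<And>x y. 0 \<le> A x y" and d_nonneg: "\<And>y. 0 \<le> d y"
    and row: "\<And>x F. x \<in> X \<Longrightarrow> finite F \<Longrightarrow> F \<subseteq> Y \<Longrightarrow> (\<Sum>y\<in>F. A x y) \<le> R"
    and col: "\<And>y F. y \<in> Y \<Longrightarrow> finite F \<Longrightarrow> F \<subseteq> X \<Longrightarrow> (\<Sum>x\<in>F. A x y) \<le> R'"
    and R: "0 \<le> R" "0 \<le> R'" and d: "(\<lambda>y. (d y)\<^sup>2) summable_on Y"
  shows "\<And>x. x \<in> X \<Longrightarrow> (\<lambda>y. A x y * d y) summable_on Y"
    and "(\<lambda>x. (\<Sum>\<^sub>\<infinity>y\<in>Y. A x y * d y)\<^sup>2) summable_on X"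
    and "(\<Sum>\<^sub>\<infinity>x\<in>X. (\<Sum>\<^sub>\<infinity>y\<in>Y. A x y * d y)\<^sup>2) \<le> R * R' * (\<Sum>\<^sub>\<infinity>y\<in>Y. (d y)\<^sup>2)"
proof -
  define D where "D = (\<Sum>\<^sub>\<infinity>y\<in>Y. (d y)\<^sup>2)"
  have sumD: "(\<Sum>y\<in>F. (d y)\<^sup>2) \<le> D" if "finite F" "F \<subseteq> Y" for F
    unfolding D_def using that d by (intro finite_sum_le_infsum) auto
  have D: "0 \<le> D" unfolding D_def by (intro infsum_nonneg) auto
  have fin: "(\<Sum>x\<in>N. (\<Sum>y\<in>F. A x y * d y)\<^sup>2) \<le> R * R' * D"
    if "finite N" "N \<subseteq> X" "finite F" "F \<subseteq> Y" for N F
  proof -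
    have "(\<Sum>x\<in>N. (\<Sum>y\<in>F. A x y * d y)\<^sup>2) \<le> (\<Sum>x\<in>N. R * (\<Sum>y\<in>F. A x y * (d y)\<^sup>2))"
    proof (rule sum_mono)
      fix x assume "x \<in> N"
      have "(\<Sum>y\<in>F. A x y * d y)\<^sup>2 = (\<Sum>y\<in>F. sqrt (A x y) * (sqrt (A x y) * d y))\<^sup>2"
        using nonneg by (simp add: mult.assoc[symmetric])
      also have "\<dots> \<le> (\<Sum>y\<in>F. (sqrt (A x y))\<^sup>2) * (\<Sum>y\<in>F. (sqrt (A x y) * d y)\<^sup>2)"
        by (rule Cauchy_Schwarz_ineq_sum)
      also have "\<dots> = (\<Sum>y\<in>F. A x y) * (\<Sum>y\<in>F. A x y * (d y)\<^sup>2)"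
        using nonneg by (simp add: power_mult_distrib)
      also have "\<dots> \<le> R * (\<Sum>y\<in>F. A x y * (d y)\<^sup>2)"
        using row[of x F] \<open>x \<in> N\<close> that nonneg by (intro mult_right_mono sum_nonneg) auto
      finally show "(\<Sum>y\<in>F. A x y * d y)\<^sup>2 \<le> R * (\<Sum>y\<in>F. A x y * (d y)\<^sup>2)" .
    qed
    also have "\<dots> = R * (\<Sum>y\<in>F. (\<Sum>x\<in>N. A x y) * (d y)\<^sup>2)"
      unfolding sum_distrib_left[symmetric] sum_distrib_right by (subst sum.swap) (rule refl)
    also have "\<dots> \<le> R * (\<Sum>y\<in>F. R' * (d y)\<^sup>2)"
      using col[of _ N] that R by (intro mult_left_mono sum_mono mult_right_mono) auto
    also have "\<dots> = R * R' * (\<Sum>y\<in>F. (d y)\<^sup>2)" by (simp add: sum_distrib_left mult.assoc)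
    also have "\<dots> \<le> R * R' * D" using sumD[of F] that R by (intro mult_left_mono) auto
    finally show ?thesis .
  qed
  show sum_Ad: "(\<lambda>y. A x y * d y) summable_on Y" if "x \<in> X" for x
  proof (rule nonneg_bdd_above_summable_on)
    show "bdd_above (sum (\<lambda>y. A x y * d y) ` {F. F \<subseteq> Y \<and> finite F})"
    proof (rule bdd_aboveI2)
      fix F assume "F \<in> {F. F \<subseteq> Y \<and> finite F}"
      then have "(\<Sum>y\<in>F. A x y * d y)\<^sup>2 \<le> R * R' * D" using fin[of "{x}" F] that by auto
      then show "(\<Sum>y\<in>F. A x y * d y) \<le> sqrt (R * R' * D)" by (rule real_le_rsqrt)
    qed
  qed (simp add: nonneg d_nonneg)
  have lim: "(\<Sum>x\<in>N. (\<Sum>\<^sub>\<infinity>y\<in>Y. A x y * d y)\<^sup>2) \<le> R * R' * D" if N: "finite N" "N \<subseteq> X" for N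
  proof (rule tendsto_upperbound)
    show "((\<lambda>F. \<Sum>x\<in>N. (\<Sum>y\<in>F. A x y * d y)\<^sup>2) \<longlongrightarrow> (\<Sum>x\<in>N. (\<Sum>\<^sub>\<infinity>y\<in>Y. A x y * d y)\<^sup>2))
        (finite_subsets_at_top Y)"
      using sum_Ad N by (intro tendsto_sum tendsto_power infsum_tendsto) auto
    show "\<forall>\<^sub>F F in finite_subsets_at_top Y. (\<Sum>x\<in>N. (\<Sum>y\<in>F. A x y * d y)\<^sup>2) \<le> R * R' * D"
      by (rule eventually_finite_subsets_at_top_weakI) (use fin N in auto)
  qed simp
  show "(\<lambda>x. (\<Sum>\<^sub>\<infinity>y\<in>Y. A x y * d y)\<^sup>2) summable_on X"
    using lim by (intro nonneg_bdd_above_summable_on bdd_aboveI2[where M = "R * R' * D"]) auto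
  then show "(\<Sum>\<^sub>\<infinity>x\<in>X. (\<Sum>\<^sub>\<infinity>y\<in>Y. A x y * d y)\<^sup>2) \<le> R * R' * (\<Sum>\<^sub>\<infinity>y\<in>Y. (d y)\<^sup>2)"
    using lim unfolding D_def by (intro infsum_le_finite_sums) auto
qed

section \<open>Summable windows and characters modulo \<open>M\<close>\<close>

definition l1_norm :: "(int \<Rightarrow> complex) \<Rightarrow> real" where
  "l1_norm \<phi> = (\<Sum>\<^sub>\<infinity>n. cmod (\<phi> n))"

lemma l1_norm_nonneg: "0 \<le> l1_norm \<phi>"
  unfolding l1_norm_def by (intro infsum_nonneg) auto

lemma sum_le_l1_norm:
  assumes "\<phi> abs_summable_on UNIV" "finite K" "inj_on h K"
  shows "(\<Sum>k\<in>K. cmod (\<phi> (h k))) \<le> l1_norm \<phi>"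
proof -
  have "(\<Sum>k\<in>K. cmod (\<phi> (h k))) = (\<Sum>n\<in>h ` K. cmod (\<phi> n))" using assms(3) by (simp add: sum.reindex)
  also have "\<dots> \<le> l1_norm \<phi>" unfolding l1_norm_def using assms by (intro finite_sum_le_infsum) auto
  finally show ?thesis .
qed

lemma cmod_le_l1_norm: "\<phi> abs_summable_on UNIV \<Longrightarrow> cmod (\<phi> n) \<le> l1_norm \<phi>"
  using sum_le_l1_norm[of \<phi> "{n}" id] by simp

text \<open>The frequency is an integer here, unlike in \<open>gabor_atom\<close>, so that
  conjugates and differences of frequencies stay in the family and \<open>l\<close> and
  \<open>n\<close> can be exchanged.\<close>

definition osc :: "nat \<Rightarrow> int \<Rightarrow> int \<Rightarrow> complex" where
  "osc M l n = exp (2 * complex_of_real pi * \<i> * complex_of_real (real_of_int (l * n) / real M))"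

lemma norm_osc [simp]: "cmod (osc M l n) = 1"
  by (simp add: osc_def)

lemma cnj_osc: "cnj (osc M l n) = osc M (- l) n"
  by (simp add: osc_def exp_cnj)

lemma osc_add: "osc M l (n + n') = osc M l n * osc M l n'"
  by (simp add: osc_def algebra_simps add_divide_distrib flip: exp_add)

lemma osc_add_left: "osc M (l + l') n = osc M l n * osc M l' n"
  by (simp add: osc_def algebra_simps add_divide_distrib flip: exp_add)

lemma osc_commute: "osc M l n = osc M n l"
  by (simp add: osc_def mult.commute)

lemma osc_eq_1_iff: "M > 0 \<Longrightarrow> osc M 1 d = 1 \<longleftrightarrow> int M dvd d"
proof -
  assume M: "M > 0"
  have "osc M 1 d = 1 \<longleftrightarrow> (\<exists>k::int. 2 * pi * (real_of_int d / real M) = of_int (2 * k) * pi)"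
    unfolding osc_def exp_eq_1 by simp
  also have "\<dots> \<longleftrightarrow> (\<exists>k::int. real_of_int d = real_of_int (int M * k))"
  proof (intro ex_cong1)
    fix k :: int
    have "2 * pi * (real_of_int d / real M) = of_int (2 * k) * pi \<longleftrightarrow> 2 * pi * (real_of_int d / real M) = 2 * pi * of_int k"
      by (simp add: mult_ac)
    also have "\<dots> \<longleftrightarrow> real_of_int d / real M = of_int k" by (subst mult_cancel_left) simp
    also have "\<dots> \<longleftrightarrow> real_of_int d = real_of_int (int M * k)" using M by (simp add: field_simps)
    finally show "2 * pi * (real_of_int d / real M) = of_int (2 * k) * pi \<longleftrightarrow> real_of_int d = real_of_int (int M * k)" .
  qed
  also have "\<dots> \<longleftrightarrow> int M dvd d" by (simp only: of_int_eq_iff dvd_def)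
  finally show ?thesis .
qed

lemma osc_multiple: "M > 0 \<Longrightarrow> osc M l (j * int M) = 1"
proof -
  assume M: "M > 0"
  have "osc M l (j * int M) = exp (2 * complex_of_real pi * \<i> * complex_of_real (of_int (l * j)))"
    using M by (simp add: osc_def)
  also have "\<dots> = 1" unfolding exp_eq_1 by (intro conjI exI[of _ "l * j"]) simp_all
  finally show ?thesis .
qed

text \<open>A geometric sum over the powers of \<open>osc M 1 d\<close>, an \<open>M\<close>-th root
  of unity.\<close>

lemma sum_osc:
  assumes "M > 0"
  shows "(\<Sum>l<M. osc M (int l) d) = (if int M dvd d then of_nat M else 0)"
proof -
  have pow: "osc M (int l) d = osc M 1 d ^ l" for l
  proof (induction l)
    case 0 show ?case by (simp add: osc_def)
  next
    case (Suc l)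
    have "osc M (int (Suc l)) d = osc M (int l + 1) d" by (simp add: add.commute)
    then show ?case using Suc by (simp only: osc_add_left power_Suc2)
  qed
  show ?thesis
  proof (cases "int M dvd d")
    case True
    then have "osc M 1 d = 1" using osc_eq_1_iff assms by simp
    then show ?thesis using True by (simp add: pow)
  next
    case False
    then have ne: "osc M 1 d \<noteq> 1" using osc_eq_1_iff assms by simp
    have "osc M 1 d ^ M = 1" using pow[of M] osc_multiple[OF assms, of d 1] by (simp add: osc_commute[of M "int M"])
    then show ?thesis using False geometric_sum[OF ne, of M] by (simp add: pow)
  qed
qed

lemma gabor_atom_eq: "gabor_atom \<phi> a M (k, l) n = \<phi> (n - k * int a) * osc M (int l) n"
  by (simp add: gabor_atom_def mod_trans_def osc_def)

lemma norm_gabor_atom: "cmod (gabor_atom \<phi> a M i n) = cmod (\<phi> (n - fst i * int a))"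
  by (cases i) (simp add: gabor_atom_eq norm_mult)

section \<open>Boundedness of analysis and synthesis\<close>

context
  fixes \<phi> :: "int \<Rightarrow> complex" and a M :: nat
  assumes \<phi>: "\<phi> abs_summable_on UNIV" and a_pos: "a > 0"
begin

lemma gabor_atom_col: "finite F \<Longrightarrow> (\<Sum>n\<in>F. cmod (gabor_atom \<phi> a M i n)) \<le> l1_norm \<phi>"
  unfolding norm_gabor_atom by (intro sum_le_l1_norm[OF \<phi>]) (auto intro: inj_onI)

text \<open>Each translate occurs with \<open>M\<close> modulations of equal modulus; this is the
  source of the factor \<open>M\<close> in the Bessel bound.\<close>

lemma gabor_atom_row:
  assumes "finite F" "F \<subseteq> gabor_index M"
  shows "(\<Sum>i\<in>F. cmod (gabor_atom \<phi> a M i n)) \<le> real M * l1_norm \<phi>"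
proof -
  have "(\<Sum>i\<in>F. cmod (gabor_atom \<phi> a M i n)) \<le> (\<Sum>i\<in>fst ` F \<times> {0..<M}. cmod (gabor_atom \<phi> a M i n))"
  proof (rule sum_mono2)
    show "F \<subseteq> fst ` F \<times> {0..<M}" using assms by (force simp: gabor_index_def)
  qed (use assms in auto)
  also have "\<dots> = (\<Sum>k\<in>fst ` F. \<Sum>l<M. cmod (\<phi> (n - k * int a)))"
    by (simp add: norm_gabor_atom sum.cartesian_product' lessThan_atLeast0)
  also have "\<dots> = real M * (\<Sum>k\<in>fst ` F. cmod (\<phi> (n - k * int a)))" by (simp add: sum_distrib_left)
  also have "\<dots> \<le> real M * l1_norm \<phi>"
    using assms a_pos by (intro mult_left_mono sum_le_l1_norm[OF \<phi>]) (auto intro: inj_onI)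
  finally show ?thesis .
qed

lemma gabor_atom_abs_summable: "gabor_atom \<phi> a M i abs_summable_on UNIV"
  using gabor_atom_col by (intro nonneg_bdd_above_summable_on bdd_aboveI2[where M = "l1_norm \<phi>"]) auto

lemma gabor_atom_l2: "gabor_atom \<phi> a M i \<in> l2"
proof -
  have "(\<lambda>n. l1_norm \<phi> * cmod (gabor_atom \<phi> a M i n)) summable_on UNIV"
    using gabor_atom_abs_summable by (rule summable_on_cmult_right)
  then have "(\<lambda>n. (cmod (gabor_atom \<phi> a M i n))\<^sup>2) summable_on UNIV"
  proof (rule summable_on_comparison_test)
    show "(cmod (gabor_atom \<phi> a M i n))\<^sup>2 \<le> l1_norm \<phi> * cmod (gabor_atom \<phi> a M i n)" for n
      unfolding power2_eq_square norm_gabor_atom by (intro mult_right_mono cmod_le_l1_norm \<phi>) auto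
  qed auto
  then show ?thesis by (simp add: l2_def)
qed

lemma l2_inner_gabor_abs_summable:
  assumes "f \<in> l2"
  shows "(\<lambda>n. f n * cnj (gabor_atom \<phi> a M i n)) abs_summable_on UNIV"
proof -
  have "(\<lambda>n. cmod (gabor_atom \<phi> a M i n) * cmod (f n)) summable_on UNIV"
    by (rule schur_test(1)[where X = "{i}" and A = "\<lambda>i n. cmod (gabor_atom \<phi> a M i n)" and R = "l1_norm \<phi>" and R' = "l1_norm \<phi>"])
       (use assms gabor_atom_col in \<open>auto simp: l2_def l1_norm_nonneg norm_gabor_atom cmod_le_l1_norm[OF \<phi>]
          subset_singleton_iff\<close>)
  then show ?thesis by (simp add: norm_mult mult.commute)
qed

lemma gabor_bessel:
  assumes "f \<in> l2"
  shows "(\<lambda>i. (cmod (l2_inner f (gabor_atom \<phi> a M i)))\<^sup>2) summable_on gabor_index M"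
    and "(\<Sum>\<^sub>\<infinity>i\<in>gabor_index M. (cmod (l2_inner f (gabor_atom \<phi> a M i)))\<^sup>2) \<le> real M * (l1_norm \<phi>)\<^sup>2 * l2_norm_sq f"
proof -
  let ?A = "\<lambda>i n. cmod (gabor_atom \<phi> a M i n)"
  note schur = schur_test[where X = "gabor_index M" and Y = UNIV and A = ?A and R = "l1_norm \<phi>"
      and R' = "real M * l1_norm \<phi>" and d = "\<lambda>n. cmod (f n)"]
  have sm: "(\<lambda>i. (\<Sum>\<^sub>\<infinity>n. ?A i n * cmod (f n))\<^sup>2) summable_on gabor_index M"
    by (rule schur) (use assms in \<open>auto intro: gabor_atom_row gabor_atom_col simp: l2_def l1_norm_nonneg\<close>)
  have le: "(\<Sum>\<^sub>\<infinity>i\<in>gabor_index M. (\<Sum>\<^sub>\<infinity>n. ?A i n * cmod (f n))\<^sup>2) \<le> l1_norm \<phi> * (real M * l1_norm \<phi>) * (\<Sum>\<^sub>\<infinity>n. (cmod (f n))\<^sup>2)"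
    by (rule schur) (use assms in \<open>auto intro: gabor_atom_row gabor_atom_col simp: l2_def l1_norm_nonneg\<close>)
  have bnd: "(cmod (l2_inner f (gabor_atom \<phi> a M i)))\<^sup>2 \<le> (\<Sum>\<^sub>\<infinity>n. ?A i n * cmod (f n))\<^sup>2" for i
    using norm_infsum_bound[OF l2_inner_gabor_abs_summable[OF assms, of i]]
    by (intro power_mono) (simp_all add: l2_inner_def norm_mult mult.commute)
  show sm': "(\<lambda>i. (cmod (l2_inner f (gabor_atom \<phi> a M i)))\<^sup>2) summable_on gabor_index M"
    using sm by (rule summable_on_comparison_test) (auto intro: bnd)
  have "(\<Sum>\<^sub>\<infinity>i\<in>gabor_index M. (cmod (l2_inner f (gabor_atom \<phi> a M i)))\<^sup>2)
      \<le> (\<Sum>\<^sub>\<infinity>i\<in>gabor_index M. (\<Sum>\<^sub>\<infinity>n. ?A i n * cmod (f n))\<^sup>2)"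
    using sm' sm by (rule infsum_mono) (rule bnd)
  also note le
  finally show "(\<Sum>\<^sub>\<infinity>i\<in>gabor_index M. (cmod (l2_inner f (gabor_atom \<phi> a M i)))\<^sup>2) \<le> real M * (l1_norm \<phi>)\<^sup>2 * l2_norm_sq f"
    by (simp add: l2_norm_sq_def power2_eq_square mult_ac)
qed

lemma gabor_synthesis:
  assumes "(\<lambda>i. (cmod (c i))\<^sup>2) summable_on gabor_index M"
  defines "s \<equiv> \<lambda>n. \<Sum>\<^sub>\<infinity>i\<in>gabor_index M. c i * gabor_atom \<phi> a M i n"
  shows "(\<lambda>i. c i * gabor_atom \<phi> a M i n) abs_summable_on gabor_index M"
    and "s \<in> l2"
    and "l2_norm_sq s \<le> real M * (l1_norm \<phi>)\<^sup>2 * (\<Sum>\<^sub>\<infinity>i\<in>gabor_index M. (cmod (c i))\<^sup>2)"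
proof -
  let ?A = "\<lambda>n i. cmod (gabor_atom \<phi> a M i n)"
  note schur = schur_test[where X = UNIV and Y = "gabor_index M" and A = ?A and R' = "l1_norm \<phi>"
      and R = "real M * l1_norm \<phi>" and d = "\<lambda>i. cmod (c i)"]
  have "(\<lambda>i. ?A n i * cmod (c i)) summable_on gabor_index M" for n
    by (rule schur) (use assms in \<open>auto intro: gabor_atom_row gabor_atom_col simp: l1_norm_nonneg\<close>)
  then show as: "(\<lambda>i. c i * gabor_atom \<phi> a M i n) abs_summable_on gabor_index M" for n
    by (simp add: norm_mult mult.commute)
  have sm: "(\<lambda>n. (\<Sum>\<^sub>\<infinity>i\<in>gabor_index M. ?A n i * cmod (c i))\<^sup>2) summable_on UNIV"
    by (rule schur) (use assms in \<open>auto intro: gabor_atom_row gabor_atom_col simp: l1_norm_nonneg\<close>)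
  have le: "(\<Sum>\<^sub>\<infinity>n. (\<Sum>\<^sub>\<infinity>i\<in>gabor_index M. ?A n i * cmod (c i))\<^sup>2)
      \<le> real M * l1_norm \<phi> * l1_norm \<phi> * (\<Sum>\<^sub>\<infinity>i\<in>gabor_index M. (cmod (c i))\<^sup>2)"
    by (rule schur) (use assms in \<open>auto intro: gabor_atom_row gabor_atom_col simp: l1_norm_nonneg\<close>)
  have bnd: "(cmod (s n))\<^sup>2 \<le> (\<Sum>\<^sub>\<infinity>i\<in>gabor_index M. ?A n i * cmod (c i))\<^sup>2" for n
    using norm_infsum_bound[OF as[of n]]
    by (intro power_mono) (simp_all add: s_def norm_mult mult.commute)
  have sm': "(\<lambda>n. (cmod (s n))\<^sup>2) summable_on UNIV"
    using sm by (rule summable_on_comparison_test) (auto intro: bnd)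
  then show "s \<in> l2" by (simp add: l2_def)
  have "l2_norm_sq s \<le> (\<Sum>\<^sub>\<infinity>n. (\<Sum>\<^sub>\<infinity>i\<in>gabor_index M. ?A n i * cmod (c i))\<^sup>2)"
    unfolding l2_norm_sq_def using sm' sm by (rule infsum_mono) (rule bnd)
  also note le
  finally show "l2_norm_sq s \<le> real M * (l1_norm \<phi>)\<^sup>2 * (\<Sum>\<^sub>\<infinity>i\<in>gabor_index M. (cmod (c i))\<^sup>2)"
    by (simp add: power2_eq_square mult_ac)
qed

end

section \<open>Reconstruction and frames from biorthogonal windows\<close>

lemma has_sum_finite_sum:
  fixes f :: "'l \<Rightarrow> 'x \<Rightarrow> complex"
  assumes "finite S" "\<And>l. l \<in> S \<Longrightarrow> (f l has_sum g l) A"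
  shows "((\<lambda>x. \<Sum>l\<in>S. f l x) has_sum (\<Sum>l\<in>S. g l)) A"
  using assms
proof (induction S rule: finite_induct)
  case (insert l S)
  then show ?case by (simp add: has_sum_add)
qed simp

lemma l2_bounded:
  assumes "f \<in> l2"
  obtains B where "\<And>n. cmod (f n) \<le> B" "B \<ge> 0"
proof -
  have "(cmod (f n))\<^sup>2 \<le> l2_norm_sq f" for n
    using finite_sum_le_infsum[of "\<lambda>n. (cmod (f n))\<^sup>2" UNIV "{n}"] assms by (auto simp: l2_def l2_norm_sq_def)
  then have "cmod (f n) \<le> sqrt (l2_norm_sq f)" for n by (rule real_le_rsqrt)
  then show ?thesis using that by (meson norm_ge_zero order_trans)
qed

lemma sum_gabor_atoms_period:
  assumes "M > 0"
  shows "(\<Sum>l<M. cnj (gabor_atom \<phi> a M (k, l) \<nu>) * gabor_atom \<psi> a M (k, l) n)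
    = (if int M dvd n - \<nu> then of_nat M * (cnj (\<phi> (\<nu> - k * int a)) * \<psi> (n - k * int a)) else 0)"
proof -
  have "cnj (gabor_atom \<phi> a M (k, l) \<nu>) * gabor_atom \<psi> a M (k, l) n
      = cnj (\<phi> (\<nu> - k * int a)) * \<psi> (n - k * int a) * osc M (int l) (n - \<nu>)" for l
  proof -
    have "osc M (- int l) \<nu> = osc M (int l) (- \<nu>)" by (simp add: osc_def)
    then have "cnj (osc M (int l) \<nu>) * osc M (int l) n = osc M (int l) (n - \<nu>)"
      using osc_add[of M "int l" n "- \<nu>"] by (simp add: cnj_osc mult.commute)
    then show ?thesis by (simp add: gabor_atom_eq mult_ac)
  qed
  then show ?thesis by (simp add: sum_distrib_left[symmetric] sum_osc[OF assms])
qed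

text \<open>A Walnut type formula: summing over the modulations removes all samples of
  \<open>f\<close> outside n + M \<int>.\<close>

lemma gabor_coefficient_sum:
  assumes \<phi>: "\<phi> abs_summable_on UNIV" and a: "a > 0" and M: "M > 0" and f: "f \<in> l2"
  shows "(\<Sum>l<M. l2_inner f (gabor_atom \<phi> a M (k, l)) * gabor_atom \<psi> a M (k, l) n)
    = (\<Sum>\<^sub>\<infinity>j. f (n + j * int M) * (of_nat M * (cnj (\<phi> (n + j * int M - k * int a)) * \<psi> (n - k * int a))))"
proof -
  note as = l2_inner_gabor_abs_summable[OF \<phi> a f, of M]
  have "(\<Sum>l<M. l2_inner f (gabor_atom \<phi> a M (k, l)) * gabor_atom \<psi> a M (k, l) n)
      = (\<Sum>l<M. \<Sum>\<^sub>\<infinity>\<nu>. f \<nu> * cnj (gabor_atom \<phi> a M (k, l) \<nu>) * gabor_atom \<psi> a M (k, l) n)"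
    unfolding l2_inner_def by (simp only: infsum_cmult_left'[symmetric])
  also have "\<dots> = (\<Sum>\<^sub>\<infinity>\<nu>. \<Sum>l<M. f \<nu> * cnj (gabor_atom \<phi> a M (k, l) \<nu>) * gabor_atom \<psi> a M (k, l) n)"
  proof (rule infsumI[symmetric])
    show "((\<lambda>\<nu>. \<Sum>l<M. f \<nu> * cnj (gabor_atom \<phi> a M (k, l) \<nu>) * gabor_atom \<psi> a M (k, l) n) has_sum
      (\<Sum>l<M. \<Sum>\<^sub>\<infinity>\<nu>. f \<nu> * cnj (gabor_atom \<phi> a M (k, l) \<nu>) * gabor_atom \<psi> a M (k, l) n)) UNIV"
      by (rule has_sum_finite_sum[OF finite_lessThan], rule has_sum_infsum, rule summable_on_cmult_left,
          rule abs_summable_summable, rule as)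
  qed
  also have "\<dots> = (\<Sum>\<^sub>\<infinity>\<nu>. f \<nu> * (if int M dvd n - \<nu> then of_nat M * (cnj (\<phi> (\<nu> - k * int a)) * \<psi> (n - k * int a)) else 0))"
    unfolding sum_gabor_atoms_period[OF M, symmetric] sum_distrib_left mult.assoc ..
  also have "\<dots> = (\<Sum>\<^sub>\<infinity>\<nu>\<in>range (\<lambda>j. n + j * int M). f \<nu> * (of_nat M * (cnj (\<phi> (\<nu> - k * int a)) * \<psi> (n - k * int a))))"
  proof (rule infsum_cong_neutral)
    fix \<nu> assume "\<nu> \<in> UNIV - range (\<lambda>j. n + j * int M)"
    moreover have "\<nu> \<in> range (\<lambda>j. n + j * int M)" if "int M dvd n - \<nu>"
    proof -
      from that obtain q where "n - \<nu> = int M * q" by (rule dvdE)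
      then have "\<nu> = n + (- q) * int M" by (simp add: mult.commute)
      then show ?thesis by blast
    qed
    ultimately show "f \<nu> * (if int M dvd n - \<nu> then of_nat M * (cnj (\<phi> (\<nu> - k * int a)) * \<psi> (n - k * int a)) else 0) = 0"
      by auto
  qed auto
  also have "\<dots> = (\<Sum>\<^sub>\<infinity>j. f (n + j * int M) * (of_nat M * (cnj (\<phi> (n + j * int M - k * int a)) * \<psi> (n - k * int a))))"
    using M by (subst infsum_reindex) (auto simp: o_def intro: injI)
  finally show ?thesis .
qed

text \<open>The Wexler--Raz type condition under which analysis with \<open>\<phi>\<close> followed by synthesis with \<open>\<psi>\<close> is the identity.\<close>

definition biorthogonal_windows :: "(int \<Rightarrow> complex) \<Rightarrow> (int \<Rightarrow> complex) \<Rightarrow> nat \<Rightarrow> nat \<Rightarrow> bool" where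
  "biorthogonal_windows \<phi> \<psi> a M \<longleftrightarrow> (\<forall>n j. ((\<lambda>k. of_nat M * (cnj (\<phi> (n + j * int M - k * int a)) * \<psi> (n - k * int a)))
     has_sum (if j = 0 then 1 else 0)) UNIV)"

text \<open>The swapped condition at (n, j) is the conjugate of the given one at (n + j M, - j). It
  yields the frame property of the dual system, which a dual window must have.\<close>

lemma biorthogonal_windows_sym:
  assumes "biorthogonal_windows \<phi> \<psi> a M"
  shows "biorthogonal_windows \<psi> \<phi> a M"
  unfolding biorthogonal_windows_def
proof (intro allI)
  fix n j :: int
  have "((\<lambda>k. of_nat M * (cnj (\<phi> ((n + j * int M) + (- j) * int M - k * int a)) * \<psi> ((n + j * int M) - k * int a)))
     has_sum (if - j = 0 then 1 else 0)) UNIV"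
    using assms unfolding biorthogonal_windows_def by blast
  then have "((\<lambda>k. cnj (of_nat M * (cnj (\<phi> (n - k * int a)) * \<psi> (n + j * int M - k * int a))))
     has_sum cnj (if j = 0 then 1 else 0)) UNIV"
    by (subst has_sum_cnj_iff) simp
  then show "((\<lambda>k. of_nat M * (cnj (\<psi> (n + j * int M - k * int a)) * \<phi> (n - k * int a)))
     has_sum (if j = 0 then 1 else 0)) UNIV"
    by (simp add: mult.commute if_distrib[of cnj] cong: if_cong)
qed

context
  fixes \<phi> \<psi> :: "int \<Rightarrow> complex" and a M :: nat
  assumes \<phi>: "\<phi> abs_summable_on UNIV" and \<psi>: "\<psi> abs_summable_on UNIV"
    and a_pos: "a > 0" and M_pos: "M > 0" and bi: "biorthogonal_windows \<phi> \<psi> a M"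
begin

lemma gabor_reconstruction:
  assumes f: "f \<in> l2"
  shows "(\<Sum>\<^sub>\<infinity>i\<in>gabor_index M. l2_inner f (gabor_atom \<phi> a M i) * gabor_atom \<psi> a M i n) = f n"
proof -
  let ?c = "\<lambda>i. l2_inner f (gabor_atom \<phi> a M i) * gabor_atom \<psi> a M i n"
  let ?h = "\<lambda>k j. f (n + j * int M) * (of_nat M * (cnj (\<phi> (n + j * int M - k * int a)) * \<psi> (n - k * int a)))"
  have c: "?c abs_summable_on gabor_index M"
    by (intro gabor_synthesis(1)[OF \<psi> a_pos] gabor_bessel(1)[OF \<phi> a_pos f])
  have "(\<Sum>\<^sub>\<infinity>i\<in>gabor_index M. ?c i) = (\<Sum>\<^sub>\<infinity>k. \<Sum>\<^sub>\<infinity>l\<in>{0..<M}. ?c (k, l))"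
    unfolding gabor_index_def
    by (rule infsum_Sigma_banach[symmetric]) (use abs_summable_summable[OF c] in \<open>simp add: gabor_index_def\<close>)
  also have "\<dots> = (\<Sum>\<^sub>\<infinity>k. \<Sum>\<^sub>\<infinity>j. ?h k j)"
    by (simp add: gabor_coefficient_sum[OF \<phi> a_pos M_pos f, symmetric] lessThan_atLeast0)
  also have "\<dots> = (\<Sum>\<^sub>\<infinity>j. \<Sum>\<^sub>\<infinity>k. ?h k j)"
  proof (rule infsum_swap_banach)
    obtain B where B: "\<And>n. cmod (f n) \<le> B" "B \<ge> 0" using l2_bounded[OF f] by blast
    \<comment> \<open>Absolute convergence of the double series: \<open>f\<close> enters through its
      bound \<open>B\<close>, the sum over \<open>j\<close> is bounded by the norm of
      \<open>\<phi>\<close>, and the sum over \<open>k\<close> by that of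
      \<open>\<psi>\<close>.\<close>
    define C where "C = B * (real M * (l1_norm \<psi> * l1_norm \<phi>))"
    have "(\<lambda>(k, j). ?h k j) abs_summable_on UNIV \<times> UNIV"
    proof (rule nonneg_bdd_above_summable_on)
      show "bdd_above (sum (\<lambda>x. cmod (case x of (k, j) \<Rightarrow> ?h k j)) ` {F. F \<subseteq> UNIV \<times> UNIV \<and> finite F})"
      proof (rule bdd_aboveI2)
        fix F :: "(int \<times> int) set" assume "F \<in> {F. F \<subseteq> UNIV \<times> UNIV \<and> finite F}"
        then have F: "finite F" by simp
        have "(\<Sum>x\<in>F. cmod (case x of (k, j) \<Rightarrow> ?h k j)) \<le> (\<Sum>x\<in>fst ` F \<times> snd ` F. cmod (case x of (k, j) \<Rightarrow> ?h k j))"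
          using F by (intro sum_mono2 subset_fst_snd) auto
        also have "\<dots> = (\<Sum>k\<in>fst ` F. \<Sum>j\<in>snd ` F. cmod (?h k j))"
          by (simp add: sum.cartesian_product')
        also have "\<dots> \<le> (\<Sum>k\<in>fst ` F. \<Sum>j\<in>snd ` F. B * (real M * (cmod (\<phi> (n + j * int M - k * int a)) * cmod (\<psi> (n - k * int a)))))"
          using B by (intro sum_mono) (auto simp: norm_mult intro!: mult_right_mono)
        also have "\<dots> = B * (real M * (\<Sum>k\<in>fst ` F. cmod (\<psi> (n - k * int a)) * (\<Sum>j\<in>snd ` F. cmod (\<phi> (n + j * int M - k * int a)))))"
          by (simp add: sum_distrib_left mult_ac)
        also have "\<dots> \<le> B * (real M * (\<Sum>k\<in>fst ` F. cmod (\<psi> (n - k * int a)) * l1_norm \<phi>))"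
          using B F M_pos by (intro mult_left_mono sum_mono sum_le_l1_norm[OF \<phi>]) (auto intro: inj_onI)
        also have "\<dots> = B * (real M * ((\<Sum>k\<in>fst ` F. cmod (\<psi> (n - k * int a))) * l1_norm \<phi>))"
          by (simp only: sum_distrib_right)
        also have "\<dots> \<le> C"
          unfolding C_def using B F a_pos
          by (intro mult_left_mono mult_right_mono sum_le_l1_norm[OF \<psi>]) (auto intro: inj_onI simp: l1_norm_nonneg)
        finally show "(\<Sum>x\<in>F. cmod (case x of (k, j) \<Rightarrow> ?h k j)) \<le> C" .
      qed
    qed auto
    then show "(\<lambda>(k, j). ?h k j) summable_on UNIV \<times> UNIV" by (rule abs_summable_summable)
  qed
  also have "\<dots> = (\<Sum>\<^sub>\<infinity>j. f (n + j * int M) * (if j = 0 then 1 else 0))"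
  proof (rule infsum_cong)
    fix j
    have "(\<Sum>\<^sub>\<infinity>k. of_nat M * (cnj (\<phi> (n + j * int M - k * int a)) * \<psi> (n - k * int a))) = (if j = 0 then 1 else 0)"
      using bi unfolding biorthogonal_windows_def by (intro infsumI) blast
    then show "(\<Sum>\<^sub>\<infinity>k. ?h k j) = f (n + j * int M) * (if j = 0 then 1 else 0)"
      by (simp only: infsum_cmult_right'[of "f (n + j * int M)"])
  qed
  also have "\<dots> = f n"
    by (rule infsumI, rule has_sum_finite_neutralI[of "{0}"]) auto
  finally show ?thesis .
qed

text \<open>The lower bound is the boundedness of synthesis with \<open>\<psi>\<close>, applied to
  the reconstruction of \<open>f\<close>. Adding 1 keeps the constants positive.\<close>

lemma biorthogonal_frame: "is_frame (gabor_atom \<phi> a M) (gabor_index M)"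
  unfolding is_frame_def
proof (intro conjI ballI)
  show "gabor_atom \<phi> a M i \<in> l2" for i by (rule gabor_atom_l2[OF \<phi> a_pos])
  define A where "A = real M * (l1_norm \<psi>)\<^sup>2 + 1"
  define B where "B = real M * (l1_norm \<phi>)\<^sup>2 + 1"
  have pos: "A > 0" "B > 0" by (simp_all add: A_def B_def add_nonneg_pos)
  show "\<exists>A B. A > 0 \<and> B > 0 \<and> (\<forall>f\<in>l2.
        (\<lambda>i. (cmod (l2_inner f (gabor_atom \<phi> a M i)))\<^sup>2) summable_on gabor_index M \<and>
        A * l2_norm_sq f \<le> (\<Sum>\<^sub>\<infinity>i\<in>gabor_index M. (cmod (l2_inner f (gabor_atom \<phi> a M i)))\<^sup>2) \<and>
        (\<Sum>\<^sub>\<infinity>i\<in>gabor_index M. (cmod (l2_inner f (gabor_atom \<phi> a M i)))\<^sup>2) \<le> B * l2_norm_sq f)"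
  proof (rule exI[of _ "1 / A"], rule exI[of _ B], intro conjI ballI)
    fix f assume f: "f \<in> l2"
    define S where "S = (\<Sum>\<^sub>\<infinity>i\<in>gabor_index M. (cmod (l2_inner f (gabor_atom \<phi> a M i)))\<^sup>2)"
    have S: "0 \<le> S" unfolding S_def by (intro infsum_nonneg) auto
    show sm: "(\<lambda>i. (cmod (l2_inner f (gabor_atom \<phi> a M i)))\<^sup>2) summable_on gabor_index M"
      by (rule gabor_bessel[OF \<phi> a_pos f])
    have "l2_norm_sq f \<le> real M * (l1_norm \<psi>)\<^sup>2 * S"
      using gabor_synthesis(3)[OF \<psi> a_pos sm] unfolding gabor_reconstruction[OF f] S_def by simp
    also have "\<dots> \<le> A * S" using S by (simp add: A_def distrib_right)
    finally show "1 / A * l2_norm_sq f \<le> S" using pos by (simp add: field_simps)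
    have "0 \<le> l2_norm_sq f" unfolding l2_norm_sq_def by (intro infsum_nonneg) auto
    then show "S \<le> B * l2_norm_sq f"
      using gabor_bessel(2)[OF \<phi> a_pos f, of M] by (simp add: S_def B_def distrib_right)
  qed (use pos in auto)
qed

text \<open>The remainder after \<open>F\<close> is the synthesis of the coefficients outside
  \<open>F\<close>, so a tail of the series of their squares controls it.\<close>

lemma biorthogonal_l2_has_sum:
  assumes f: "f \<in> l2"
  shows "l2_has_sum (\<lambda>i n. l2_inner f (gabor_atom \<phi> a M i) * gabor_atom \<psi> a M i n) (gabor_index M) f"
  unfolding l2_has_sum_def
proof (intro allI impI)
  fix \<epsilon> :: real assume \<epsilon>: "\<epsilon> > 0"
  let ?c = "\<lambda>i. l2_inner f (gabor_atom \<phi> a M i)"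
  let ?I = "gabor_index M"
  define B where "B = real M * (l1_norm \<psi>)\<^sup>2 + 1"
  have B: "B > 0" by (simp add: B_def add_nonneg_pos)
  have sm: "(\<lambda>i. (cmod (?c i))\<^sup>2) summable_on ?I" by (rule gabor_bessel[OF \<phi> a_pos f])
  define T where "T = (\<Sum>\<^sub>\<infinity>i\<in>?I. (cmod (?c i))\<^sup>2)"
  obtain F0 where F0: "finite F0" "F0 \<subseteq> ?I" "dist (\<Sum>i\<in>F0. (cmod (?c i))\<^sup>2) T \<le> \<epsilon> / (2 * B)"
    using infsum_finite_approximation[OF sm, of "\<epsilon> / (2 * B)"] \<epsilon> B unfolding T_def by auto
  show "\<exists>F0. finite F0 \<and> F0 \<subseteq> ?I \<and> (\<forall>F. finite F \<and> F0 \<subseteq> F \<and> F \<subseteq> ?I \<longrightarrow>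
      l2_norm_sq (\<lambda>n. f n - (\<Sum>i\<in>F. ?c i * gabor_atom \<psi> a M i n)) < \<epsilon>)"
  proof (intro exI[of _ F0] conjI allI impI F0(1,2))
    fix F assume F: "finite F \<and> F0 \<subseteq> F \<and> F \<subseteq> ?I"
    define d where "d = (\<lambda>i. if i \<in> F then 0 else ?c i)"
    have smd: "(\<lambda>i. (cmod (d i))\<^sup>2) summable_on ?I"
      using sm by (rule summable_on_comparison_test) (auto simp: d_def)
    have split: "infsum h ?I = infsum h F + infsum h (?I - F)" if "h summable_on ?I" for h :: "int \<times> nat \<Rightarrow> 'b::banach"
    proof -
      have "infsum h (F \<union> (?I - F)) = infsum h F + infsum h (?I - F)"
        using F by (intro infsum_Un_disjoint summable_on_finite summable_on_subset_banach[OF that]) auto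
      then show ?thesis using F by (simp add: Un_absorb1)
    qed
    have dd: "(\<Sum>\<^sub>\<infinity>i\<in>?I. (cmod (d i))\<^sup>2) = (\<Sum>\<^sub>\<infinity>i\<in>?I - F. (cmod (?c i))\<^sup>2)"
      by (rule infsum_cong_neutral) (auto simp: d_def)
    have ds: "(\<Sum>\<^sub>\<infinity>i\<in>?I. d i * gabor_atom \<psi> a M i n) = (\<Sum>\<^sub>\<infinity>i\<in>?I - F. ?c i * gabor_atom \<psi> a M i n)" for n
      by (rule infsum_cong_neutral) (auto simp: d_def)
    have "f n - (\<Sum>i\<in>F. ?c i * gabor_atom \<psi> a M i n) = (\<Sum>\<^sub>\<infinity>i\<in>?I. d i * gabor_atom \<psi> a M i n)" for n
      using split[OF abs_summable_summable[OF gabor_synthesis(1)[OF \<psi> a_pos sm, of n]]] F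
      by (simp add: gabor_reconstruction[OF f] ds)
    then have "l2_norm_sq (\<lambda>n. f n - (\<Sum>i\<in>F. ?c i * gabor_atom \<psi> a M i n))
        \<le> real M * (l1_norm \<psi>)\<^sup>2 * (\<Sum>\<^sub>\<infinity>i\<in>?I. (cmod (d i))\<^sup>2)"
      using gabor_synthesis(3)[OF \<psi> a_pos smd] by simp
    also have "\<dots> \<le> B * (\<Sum>\<^sub>\<infinity>i\<in>?I. (cmod (d i))\<^sup>2)"
      by (intro mult_right_mono infsum_nonneg) (auto simp: B_def)
    also have "(\<Sum>\<^sub>\<infinity>i\<in>?I. (cmod (d i))\<^sup>2) = T - (\<Sum>i\<in>F. (cmod (?c i))\<^sup>2)"
      using split[OF sm] F by (simp add: dd T_def)
    also have "B * (T - (\<Sum>i\<in>F. (cmod (?c i))\<^sup>2)) \<le> B * (T - (\<Sum>i\<in>F0. (cmod (?c i))\<^sup>2))"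
      using B F by (intro mult_left_mono diff_left_mono sum_mono2) auto
    also have "\<dots> \<le> B * (\<epsilon> / (2 * B))"
      using F0(3) B by (intro mult_left_mono) (auto simp: dist_real_def)
    also have "\<dots> < \<epsilon>" using B \<epsilon> by simp
    finally show "l2_norm_sq (\<lambda>n. f n - (\<Sum>i\<in>F. ?c i * gabor_atom \<psi> a M i n)) < \<epsilon>" .
  qed
qed

end

lemma biorthogonal_dual_window:
  assumes "\<phi> abs_summable_on UNIV" "\<psi> abs_summable_on UNIV" "a > 0" "M > 0" "biorthogonal_windows \<phi> \<psi> a M"
  shows "is_dual_window \<psi> \<phi> a M"
proof -
  have "gabor_atom \<psi> a M (0, 0) = \<psi>" by (rule ext) (simp add: gabor_atom_eq osc_def)
  then have "\<psi> \<in> l2" using gabor_atom_l2[OF assms(2,3), of M "(0, 0)"] by simp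
  then show ?thesis unfolding is_dual_window_def
    using biorthogonal_frame[OF assms(2,1,3,4) biorthogonal_windows_sym[OF assms(5)]]
      biorthogonal_l2_has_sum[OF assms] by blast
qed

section \<open>Riesz sequences from biorthogonal atoms\<close>

lemma infsum_int_residues:
  fixes h :: "int \<Rightarrow> complex"
  assumes "M > 0" "h abs_summable_on UNIV"
  shows "infsum h UNIV = (\<Sum>r<M. \<Sum>\<^sub>\<infinity>j. h (int r + j * int M))"
proof -
  have bij: "bij_betw (\<lambda>(r, j). int r + j * int M) ({..<M} \<times> UNIV) UNIV"
  proof (rule bij_betwI[where g = "\<lambda>n. (nat (n mod int M), n div int M)"])
    show "(\<lambda>n. (nat (n mod int M), n div int M)) \<in> UNIV \<rightarrow> {..<M} \<times> UNIV"
      using assms(1) by (auto simp: nat_less_iff)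
  qed (use assms(1) in \<open>auto simp: mult.commute\<close>)
  have "h summable_on UNIV" using assms(2) by (rule abs_summable_summable)
  then have "(\<lambda>x. h (case x of (r, j) \<Rightarrow> int r + j * int M)) summable_on {..<M} \<times> UNIV"
    using summable_on_reindex_bij_betw[OF bij, of h] by simp
  then have "(\<Sum>\<^sub>\<infinity>x\<in>{..<M} \<times> UNIV. h (case x of (r, j) \<Rightarrow> int r + j * int M))
      = (\<Sum>\<^sub>\<infinity>r\<in>{..<M}. \<Sum>\<^sub>\<infinity>j. h (int r + j * int M))"
    using infsum_Sigma_banach[of "\<lambda>x. h (case x of (r, j) \<Rightarrow> int r + j * int M)" "{..<M}" "\<lambda>_. UNIV"] by simp
  moreover have "(\<Sum>\<^sub>\<infinity>x\<in>{..<M} \<times> UNIV. h (case x of (r, j) \<Rightarrow> int r + j * int M)) = infsum h UNIV"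
    by (rule infsum_reindex_bij_betw[OF bij])
  ultimately show ?thesis by simp
qed

text \<open>The inner product is split by residues modulo \<open>M\<close>: the sum inside a class
  gives orthogonality in the translation index through \<open>bi\<close>, the sum over classes gives
  it in the modulation index.\<close>

lemma biorthogonal_atoms:
  assumes \<phi>: "\<phi> abs_summable_on UNIV" and \<theta>: "\<theta> abs_summable_on UNIV" and a: "a > 0" and M: "M > 0"
    and bi: "\<And>n k. ((\<lambda>j. \<phi> (n + j * int M - k * int a) * cnj (\<theta> (n + j * int M))) has_sum (if k = 0 then 1 else 0)) UNIV"
    and i: "i \<in> gabor_index M" "i' \<in> gabor_index M"
  shows "l2_inner (gabor_atom \<phi> a M i) (gabor_atom \<theta> a M i') = (if i = i' then of_nat M else 0)"
proof -
  obtain k l k' l' where kl: "i = (k, l)" "i' = (k', l')" "l < M" "l' < M"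
    using i by (auto simp: gabor_index_def)
  have "(\<lambda>n. gabor_atom \<phi> a M i n * cnj (gabor_atom \<theta> a M i' n)) abs_summable_on UNIV"
    by (rule l2_inner_gabor_abs_summable[OF \<theta> a gabor_atom_l2[OF \<phi> a]])
  then have "l2_inner (gabor_atom \<phi> a M i) (gabor_atom \<theta> a M i')
      = (\<Sum>r<M. \<Sum>\<^sub>\<infinity>j. gabor_atom \<phi> a M i (int r + j * int M) * cnj (gabor_atom \<theta> a M i' (int r + j * int M)))"
    unfolding l2_inner_def by (rule infsum_int_residues[OF M])
  also have "\<dots> = (\<Sum>r<M. osc M (int l - int l') (int r) * (if k - k' = 0 then 1 else 0))"
  proof (rule sum.cong[OF refl])
    fix r
    have o: "osc M (int l) (int r + j * int M) * cnj (osc M (int l') (int r + j * int M)) = osc M (int l - int l') (int r)" for j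
      using osc_add_left[of M "int l" "- int l'" "int r"]
      by (simp add: osc_add osc_multiple[OF M] cnj_osc)
    \<comment> \<open>This is the form of \<open>bi\<close> with base point r - k' a and translation
      index k - k'.\<close>
    have "gabor_atom \<phi> a M i (int r + j * int M) * cnj (gabor_atom \<theta> a M i' (int r + j * int M))
      = osc M (int l - int l') (int r) * (\<phi> ((int r - k' * int a) + j * int M - (k - k') * int a)
          * cnj (\<theta> ((int r - k' * int a) + j * int M)))" for j
      unfolding o[of j, symmetric] kl gabor_atom_eq by (simp add: algebra_simps)
    then show "(\<Sum>\<^sub>\<infinity>j. gabor_atom \<phi> a M i (int r + j * int M) * cnj (gabor_atom \<theta> a M i' (int r + j * int M)))
      = osc M (int l - int l') (int r) * (if k - k' = 0 then 1 else 0)"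
      by (simp only: infsum_cmult_right' infsumI[OF bi])
  qed
  also have "\<dots> = (\<Sum>r<M. osc M (int r) (int l - int l')) * (if k = k' then 1 else 0)"
    by (simp add: sum_distrib_right osc_commute[of M "int l - int l'"])
  also have "\<dots> = (if i = i' then of_nat M else 0)"
  proof -
    have "int M dvd int l - int l' \<longleftrightarrow> l = l'"
      using kl(3,4) zdvd_imp_le[of "int M" "int l - int l'"] zdvd_imp_le[of "int M" "int l' - int l"]
      by (cases l l' rule: linorder_cases) (auto simp: dvd_diff_commute)
    then show ?thesis using kl by (simp add: sum_osc[OF M])
  qed
  finally show ?thesis .
qed

text \<open>The atoms of \<open>\<theta>\<close> read off the coefficients up to the factor
  \<open>M\<close>, and the Bessel bound for \<open>\<theta>\<close> then controls them by the norm
  of the sum; hence the lower constant \<open>(real M)\<^sup>2 / A\<close>.\<close>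

lemma biorthogonal_riesz:
  assumes \<phi>: "\<phi> abs_summable_on UNIV" and \<theta>: "\<theta> abs_summable_on UNIV" and a: "a > 0" and M: "M > 0"
    and bi: "\<And>n k. ((\<lambda>j. \<phi> (n + j * int M - k * int a) * cnj (\<theta> (n + j * int M))) has_sum (if k = 0 then 1 else 0)) UNIV"
  shows "is_riesz_sequence (gabor_atom \<phi> a M) (gabor_index M)"
  unfolding is_riesz_sequence_def
proof (intro conjI ballI)
  show "gabor_atom \<phi> a M i \<in> l2" for i by (rule gabor_atom_l2[OF \<phi> a])
  let ?I = "gabor_index M"
  define A where "A = real M * (l1_norm \<theta>)\<^sup>2 + 1"
  define B where "B = real M * (l1_norm \<phi>)\<^sup>2 + 1"
  have pos: "A > 0" "B > 0" by (simp_all add: A_def B_def add_nonneg_pos)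
  have *: "(real M)\<^sup>2 / A * (\<Sum>i\<in>{i. c i \<noteq> 0}. (cmod (c i))\<^sup>2) \<le> l2_norm_sq (\<lambda>n. \<Sum>i\<in>{i. c i \<noteq> 0}. c i * gabor_atom \<phi> a M i n)
    \<and> l2_norm_sq (\<lambda>n. \<Sum>i\<in>{i. c i \<noteq> 0}. c i * gabor_atom \<phi> a M i n) \<le> B * (\<Sum>i\<in>{i. c i \<noteq> 0}. (cmod (c i))\<^sup>2)"
    if fin: "finite {i. c i \<noteq> 0}" and sub: "{i. c i \<noteq> 0} \<subseteq> ?I" for c :: "int \<times> nat \<Rightarrow> complex"
  proof -
    define J where "J = {i. c i \<noteq> 0}"
    define s where "s = (\<lambda>n. \<Sum>i\<in>J. c i * gabor_atom \<phi> a M i n)"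
    have J: "finite J" "J \<subseteq> ?I" using fin sub by (simp_all add: J_def)
    have hs: "((\<lambda>i. (cmod (c i))\<^sup>2) has_sum (\<Sum>i\<in>J. (cmod (c i))\<^sup>2)) ?I"
      using J by (intro has_sum_finite_neutralI) (auto simp: J_def)
    have s_eq: "(\<Sum>\<^sub>\<infinity>i\<in>?I. c i * gabor_atom \<phi> a M i n) = s n" for n
      unfolding s_def using J by (intro infsumI has_sum_finite_neutralI) (auto simp: J_def)
    have sm: "(\<lambda>i. (cmod (c i))\<^sup>2) summable_on ?I" using hs by (rule has_sum_imp_summable)
    have sl2: "s \<in> l2" and upper: "l2_norm_sq s \<le> real M * (l1_norm \<phi>)\<^sup>2 * (\<Sum>i\<in>J. (cmod (c i))\<^sup>2)"
      using gabor_synthesis(2,3)[OF \<phi> a sm] unfolding s_eq infsumI[OF hs] by simp_all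
    have coeff: "l2_inner s (gabor_atom \<theta> a M i') = of_nat M * c i'" if i': "i' \<in> ?I" for i'
    proof -
      have "((\<lambda>n. \<Sum>i\<in>J. c i * (gabor_atom \<phi> a M i n * cnj (gabor_atom \<theta> a M i' n))) has_sum
          (\<Sum>i\<in>J. c i * l2_inner (gabor_atom \<phi> a M i) (gabor_atom \<theta> a M i'))) UNIV"
        unfolding l2_inner_def
        by (rule has_sum_finite_sum[OF J(1)], rule has_sum_cmult_right, rule has_sum_infsum,
            rule abs_summable_summable, rule l2_inner_gabor_abs_summable[OF \<theta> a gabor_atom_l2[OF \<phi> a]])
      then have "l2_inner s (gabor_atom \<theta> a M i') = (\<Sum>i\<in>J. c i * l2_inner (gabor_atom \<phi> a M i) (gabor_atom \<theta> a M i'))"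
        unfolding l2_inner_def[of s] unfolding s_def sum_distrib_right mult.assoc by (rule infsumI)
      also have "\<dots> = (\<Sum>i\<in>J. if i = i' then of_nat M * c i else 0)"
      proof (rule sum.cong[OF refl])
        fix i assume "i \<in> J"
        then have "l2_inner (gabor_atom \<phi> a M i) (gabor_atom \<theta> a M i') = (if i = i' then of_nat M else 0)"
          using J(2) i' by (intro biorthogonal_atoms[OF \<phi> \<theta> a M bi]) auto
        then show "c i * l2_inner (gabor_atom \<phi> a M i) (gabor_atom \<theta> a M i') = (if i = i' then of_nat M * c i else 0)"
          by simp
      qed
      also have "\<dots> = of_nat M * c i'" using J(1) unfolding J_def by simp
      finally show ?thesis .
    qed
    have "(real M)\<^sup>2 * (\<Sum>i\<in>J. (cmod (c i))\<^sup>2) = (\<Sum>\<^sub>\<infinity>i\<in>?I. (real M)\<^sup>2 * (cmod (c i))\<^sup>2)"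
      by (simp only: infsum_cmult_right' infsumI[OF hs])
    also have "\<dots> = (\<Sum>\<^sub>\<infinity>i\<in>?I. (cmod (l2_inner s (gabor_atom \<theta> a M i)))\<^sup>2)"
      by (intro infsum_cong) (simp add: coeff norm_mult power_mult_distrib)
    also have "\<dots> \<le> real M * (l1_norm \<theta>)\<^sup>2 * l2_norm_sq s" by (rule gabor_bessel(2)[OF \<theta> a sl2])
    also have "\<dots> \<le> A * l2_norm_sq s"
      unfolding l2_norm_sq_def by (intro mult_right_mono infsum_nonneg) (auto simp: A_def)
    finally have "(real M)\<^sup>2 / A * (\<Sum>i\<in>J. (cmod (c i))\<^sup>2) \<le> l2_norm_sq s"
      using pos by (simp add: field_simps)
    moreover have "real M * (l1_norm \<phi>)\<^sup>2 * (\<Sum>i\<in>J. (cmod (c i))\<^sup>2) \<le> B * (\<Sum>i\<in>J. (cmod (c i))\<^sup>2)"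
      by (intro mult_right_mono sum_nonneg) (auto simp: B_def)
    ultimately show ?thesis using upper unfolding s_def J_def by linarith
  qed
  show "\<exists>A B. A > 0 \<and> B > 0 \<and> (\<forall>c::int \<times> nat \<Rightarrow> complex.
        finite {i. c i \<noteq> 0} \<longrightarrow> {i. c i \<noteq> 0} \<subseteq> ?I \<longrightarrow>
        A * (\<Sum>i\<in>{i. c i \<noteq> 0}. (cmod (c i))\<^sup>2)
          \<le> l2_norm_sq (\<lambda>n. \<Sum>i\<in>{i. c i \<noteq> 0}. c i * gabor_atom \<phi> a M i n) \<and>
        l2_norm_sq (\<lambda>n. \<Sum>i\<in>{i. c i \<noteq> 0}. c i * gabor_atom \<phi> a M i n)
          \<le> B * (\<Sum>i\<in>{i. c i \<noteq> 0}. (cmod (c i))\<^sup>2))"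
  proof (rule exI[of _ "(real M)\<^sup>2 / A"], rule exI[of _ B], intro conjI allI impI)
    show "(real M)\<^sup>2 / A > 0" using pos M by simp
  qed (use * pos in blast)+
qed

section \<open>Sampled totally positive functions\<close>

lemma sample_abs_summable:
  assumes "exp_decay \<beta> g" "\<beta> > 0"
  shows "sample g abs_summable_on UNIV"
proof -
  obtain A where A: "A \<ge> 0" "\<And>x. \<bar>g x\<bar> \<le> A * exp (- \<beta> * \<bar>x\<bar>)" using exp_decayE[OF assms(1)] by blast
  define h where "h = (\<lambda>n::int. A * exp (- \<beta> * \<bar>real_of_int n\<bar>))"
  have geo: "(\<lambda>n::nat. A * exp (- \<beta> * real n)) summable_on UNIV"
  proof (rule summable_on_cmult_right)
    have "summable (\<lambda>n. exp (- \<beta>) ^ n)" using assms(2) by (intro summable_geometric) simp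
    then have "summable (\<lambda>n::nat. exp (- \<beta> * real n))" by (simp add: exp_of_nat_mult[symmetric] mult.commute)
    then show "(\<lambda>n::nat. exp (- \<beta> * real n)) summable_on UNIV"
      by (intro summable_nonneg_imp_summable_on) auto
  qed
  have "h summable_on range int" "h summable_on range (\<lambda>n. - int n)"
    using geo by (auto simp: summable_on_reindex inj_on_def o_def h_def)
  then have "h summable_on range int \<union> range (\<lambda>n. - int n)" by (rule summable_on_union)
  also have "range int \<union> range (\<lambda>n. - int n) = UNIV"
    by (auto simp: image_iff) (metis int_cases2)
  finally show ?thesis
    by (rule summable_on_comparison_test) (use A(2) in \<open>auto simp: sample_def h_def\<close>)
qed

lemma finite_support_abs_summable:
  fixes \<phi> :: "int \<Rightarrow> complex"
  assumes "finite {n. \<phi> n \<noteq> 0}"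
  shows "\<phi> abs_summable_on UNIV"
  by (rule finite_nonzero_values_imp_summable_on) (use assms in simp)

text \<open>The equations for different residues of \<open>n\<close> modulo \<open>p\<close> involve
  disjoint sets of values of \<open>\<gamma>\<close>, and those for \<open>n\<close> and
  \<open>n + p\<close> agree up to a shift of \<open>k\<close>. So \<open>p\<close> finite problems
  determine \<open>\<gamma>\<close>, and its support is finite.\<close>

lemma finitely_supported_sampled_dual:
  fixes p q :: nat
  assumes tp: "totally_positive_finite_type g m" and m: "m \<ge> 2" and cont: "continuous_on UNIV g"
    and p: "0 < p" "p < q"
  obtains \<gamma> :: "int \<Rightarrow> real" where "finite {n. \<gamma> n \<noteq> 0}"
    "\<And>n j. ((\<lambda>k. \<gamma> (n - k * int p) * g (real_of_int (n + j * int q - k * int p)))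
       has_sum (if j = 0 then 1 else 0)) UNIV"
proof -
  obtain C \<delta> i where C: "C > 0" and \<delta>: "\<And>k. \<delta> k \<noteq> 0" and g: "g = (\<lambda>x. C * tp_kernel \<delta> (Suc i) x)"
    using totally_positive_kernel[OF tp m cont] by blast
  have "\<exists>c S. finite S \<and> (\<forall>j::int. (\<Sum>k\<in>S. c k * tp_kernel \<delta> (Suc i) (real_of_int n + real q * of_int j - real p * of_int (k::int)))
    = (if j = 0 then 1 else 0))" for n
    using p by (intro tp_kernel_dual_coefficients \<delta>) auto
  then obtain c S where S: "\<And>n::int. finite (S n)" and
    c: "\<And>n j. (\<Sum>k\<in>S n. c n k * tp_kernel \<delta> (Suc i) (real_of_int n + real q * of_int j - real p * of_int (k::int))) = (if j = 0 then 1 else 0)"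
    by metis
  define d where "d = (\<lambda>n k. if k \<in> S n then c n k / C else 0)"
  have d: "((\<lambda>k. d n k * g (real_of_int (n + j * int q - k * int p))) has_sum (if j = 0 then 1 else 0)) UNIV" for n j
  proof (rule has_sum_finite_neutralI[of "S n"])
    have "(\<Sum>k\<in>S n. d n k * g (real_of_int (n + j * int q - k * int p)))
      = (\<Sum>k\<in>S n. c n k * tp_kernel \<delta> (Suc i) (real_of_int n + real q * of_int j - real p * of_int k))"
      using C by (intro sum.cong) (simp_all add: d_def g mult.commute)
    then show "(if j = 0 then 1 else 0) = (\<Sum>k\<in>S n. d n k * g (real_of_int (n + j * int q - k * int p)))"
      using c by simp
  qed (auto simp: S d_def)
  \<comment> \<open>The position \<open>n\<close> is r - k p with r = n mod p and k = - (n div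
    p).\<close>
  define \<gamma> where "\<gamma> = (\<lambda>n. d (n mod int p) (- (n div int p)))"
  show thesis
  proof
    have "{n. \<gamma> n \<noteq> 0} \<subseteq> (\<Union>r\<in>{0..<int p}. (\<lambda>k. r - k * int p) ` S r)"
    proof
      fix n assume "n \<in> {n. \<gamma> n \<noteq> 0}"
      then have "- (n div int p) \<in> S (n mod int p)" by (auto simp: \<gamma>_def d_def split: if_splits)
      moreover have "n = n mod int p - (- (n div int p)) * int p" by simp
      moreover have "n mod int p \<in> {0..<int p}" using p by simp
      ultimately show "n \<in> (\<Union>r\<in>{0..<int p}. (\<lambda>k. r - k * int p) ` S r)" by blast
    qed
    then show "finite {n. \<gamma> n \<noteq> 0}" by (rule finite_subset) (auto simp: S)
  next
    fix n j :: int
    define r t where "r = n mod int p" and "t = n div int p"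
    have n: "n = r + t * int p" by (simp add: r_def t_def)
    have r: "0 \<le> r" "r < int p" using p by (simp_all add: r_def)
    have "bij_betw (\<lambda>k. k - t) UNIV UNIV" by (rule bij_betwI[where g = "\<lambda>k. k + t"]) auto
    then have "((\<lambda>k. d r (k - t) * g (real_of_int (r + j * int q - (k - t) * int p))) has_sum (if j = 0 then 1 else 0)) UNIV"
      using has_sum_reindex_bij_betw[of "\<lambda>k. k - t" UNIV UNIV "\<lambda>k. d r k * g (real_of_int (r + j * int q - k * int p))"] d by blast
    moreover have "\<gamma> (n - k * int p) = d r (k - t)" for k
    proof -
      have "n - k * int p = r + (t - k) * int p" by (simp add: n algebra_simps)
      then have "(n - k * int p) mod int p = r" "(n - k * int p) div int p = t - k"
        using r by simp_all
      then show ?thesis by (simp add: \<gamma>_def)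
    qed
    moreover have "r + j * int q - (k - t) * int p = n + j * int q - k * int p" for k
      by (simp add: n algebra_simps)
    ultimately show "((\<lambda>k. \<gamma> (n - k * int p) * g (real_of_int (n + j * int q - k * int p)))
       has_sum (if j = 0 then 1 else 0)) UNIV" by (simp only:)
  qed
qed

lemma totally_positive_sample_abs_summable:
  assumes "totally_positive_finite_type g m" "m \<ge> 2" "continuous_on UNIV g"
  shows "sample g abs_summable_on UNIV"
proof -
  obtain C \<delta> i where C: "C > 0" and \<delta>: "\<And>k. \<delta> k \<noteq> 0" and g: "g = (\<lambda>x. C * tp_kernel \<delta> (Suc i) x)"
    using totally_positive_kernel[OF assms] by blast
  obtain \<beta> where \<beta>: "\<beta> > 0" "exp_decay \<beta> (tp_kernel \<delta> (Suc i))" using tp_kernel_decay[of "Suc i" \<delta>] \<delta> by blast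
  have "sample (tp_kernel \<delta> (Suc i)) abs_summable_on UNIV" using sample_abs_summable \<beta> by blast
  then have "(\<lambda>n. C * cmod (sample (tp_kernel \<delta> (Suc i)) n)) summable_on UNIV" by (rule summable_on_cmult_right)
  then show ?thesis using C by (simp add: sample_def g norm_mult del: tp_kernel.simps)
qed

theorem theorem5:
  fixes g :: "real \<Rightarrow> real" and m a M :: nat
  assumes tp: "totally_positive_finite_type g m"
    and m2: "m \<ge> 2"
    and cont: "continuous_on UNIV g"
    and apos: "a > 0" and Mpos: "M > 0"
  shows "(real a / real M < 1 \<longrightarrow>
            is_frame (gabor_atom (sample g) a M) (gabor_index M) \<and>
            (\<exists>\<gamma>. finite {n. \<gamma> n \<noteq> 0} \<and> is_dual_window \<gamma> (sample g) a M))
       \<and> (real a / real M > 1 \<longrightarrow>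
            is_riesz_sequence (gabor_atom (sample g) a M) (gabor_index M))"
proof (intro conjI impI)
  note sg = totally_positive_sample_abs_summable[OF tp m2 cont]
  {
    assume "real a / real M < 1"
    then have "a < M" using Mpos by (simp add: divide_less_eq)
    then obtain \<gamma> where fin: "finite {n. \<gamma> n \<noteq> (0::real)}" and
      bi: "\<And>n j. ((\<lambda>k. \<gamma> (n - k * int a) * g (real_of_int (n + j * int M - k * int a)))
       has_sum (if j = 0 then 1 else 0)) UNIV"
      using finitely_supported_sampled_dual[OF tp m2 cont apos] by blast
    \<comment> \<open>Division by \<open>M\<close> cancels the factor \<open>M\<close> produced by
      the sum over modulations.\<close>
    define \<psi> where "\<psi> = (\<lambda>n. complex_of_real (\<gamma> n / real M))"
    have fin\<psi>: "finite {n. \<psi> n \<noteq> 0}" using fin by (rule finite_subset[rotated]) (auto simp: \<psi>_def)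
    have "biorthogonal_windows (sample g) \<psi> a M"
      unfolding biorthogonal_windows_def
    proof (intro allI)
      fix n j
      have "of_nat M * (cnj (sample g (n + j * int M - k * int a)) * \<psi> (n - k * int a))
          = complex_of_real (\<gamma> (n - k * int a) * g (real_of_int (n + j * int M - k * int a)))" for k
        using Mpos by (simp add: \<psi>_def sample_def)
      then show "((\<lambda>k. of_nat M * (cnj (sample g (n + j * int M - k * int a)) * \<psi> (n - k * int a)))
          has_sum (if j = 0 then 1 else 0)) UNIV"
        using has_sum_of_real[OF bi[of n j], where ?'a = complex] by (simp split: if_splits)
    qed
    note dual = sg finite_support_abs_summable[OF fin\<psi>] apos Mpos this
    show "is_frame (gabor_atom (sample g) a M) (gabor_index M)" by (rule biorthogonal_frame[OF dual])
    show "\<exists>\<gamma>. finite {n. \<gamma> n \<noteq> 0} \<and> is_dual_window \<gamma> (sample g) a M"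
      using fin\<psi> biorthogonal_dual_window[OF dual] by blast
  }
  assume "real a / real M > 1"
  then have "M < a" using Mpos by (simp add: less_divide_eq)
  moreover have "continuous_on UNIV (\<lambda>x. g (- x))"
    by (rule continuous_on_compose2[OF cont]) (auto intro: continuous_intros)
  ultimately obtain \<gamma> where fin: "finite {n. \<gamma> n \<noteq> (0::real)}" and
    bi: "\<And>n j. ((\<lambda>k. \<gamma> (n - k * int M) * g (- real_of_int (n + j * int a - k * int M)))
       has_sum (if j = 0 then 1 else 0)) UNIV"
    using finitely_supported_sampled_dual[OF totally_positive_reflect[OF tp] m2 _ Mpos] by blast
  \<comment> \<open>Negating the argument, together with the reflection of \<open>g\<close>, turns
    the sum over translates by \<open>M\<close> into the sum over \<open>j\<close> in the
    biorthogonality of atoms; the former \<open>j\<close> becomes the translation index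
    \<open>k\<close>.\<close>
  define \<theta> where "\<theta> = (\<lambda>n. complex_of_real (\<gamma> (- n)))"
  have "{n. \<theta> n \<noteq> 0} = uminus ` {n. \<gamma> n \<noteq> 0}" by (force simp: \<theta>_def image_iff)
  then have "finite {n. \<theta> n \<noteq> 0}" using fin by simp
  then have \<theta>: "\<theta> abs_summable_on UNIV" by (rule finite_support_abs_summable)
  show "is_riesz_sequence (gabor_atom (sample g) a M) (gabor_index M)"
  proof (rule biorthogonal_riesz[OF sg \<theta> apos Mpos])
    fix n k
    have "sample g (n + j * int M - k * int a) * cnj (\<theta> (n + j * int M))
        = complex_of_real (\<gamma> (- n - j * int M) * g (- real_of_int (- n + k * int a - j * int M)))" for j
      by (simp add: \<theta>_def sample_def algebra_simps)
    then show "((\<lambda>j. sample g (n + j * int M - k * int a) * cnj (\<theta> (n + j * int M)))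
        has_sum (if k = 0 then 1 else 0)) UNIV"
      using has_sum_of_real[OF bi[of "- n" k], where ?'a = complex] by (simp split: if_splits)
  qed
qed

end
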